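(* For all (unrestricted) terms $M,N$ of the call-by-value $\lambda\Box$-calculus, $M=_vN$ implies $[\![M]\!]^\dagger=_n[\![N]\!]^\dagger$.
   Context: Types: $\sigma::=p\mid\sigma\supset\sigma\mid\Box\sigma$. Terms (box bodies arbitrary): $M::=c\mid x\mid\lambda x^\sigma.M\mid MM\mid\mathbf{box}_{x_1^{\sigma_1},\dots,x_n^{\sigma_n}}(M_1,\dots,M_n;M)$. The $x_i$ are bound in the body, and the free variables of a box term are those of the $M_i$. $\vec N(\lambda\vec x.M)$ abbreviates $N_1(\lambda x_1.\cdots N_n(\lambda x_n.M)\cdots)$. Call-by-name reduction $\to_n$ is the closure under term contexts of: - $(\lambda x.M)N\to M[x:=N]$; - $\lambda x.Mx\to M$ ($x\notin FV(M)$); - $\mathbf{box}_x(M;x)\to M$; - $\mathbf{box}_{\vec w,x,\vec z}(\vec P,\mathbf{box}_{\vec y}(\vec L;N),\vec Q;M)\to\mathbf{box}_{\vec w,\vec y,\vec z}(\vec P,\vec L,\vec Q;M[x:=N])$ with $|\vec w|=|\vec P|$. Call-by-value. Values: $V::=c\mid x\mid\lambda x.M\mid\mathbf{box}_{\vec x}(V_1,\dots,V_n;M)$. Simple evaluation contexts: $C::=[\,]M\mid V[\,]\mid\mathbf{box}_{\vec x}(V_1,\dots,V_k,[\,],M_1,\dots,M_m;M)$. Evaluation contexts: $E::=[\,]\mid C[E]$. $\to_v$ is the closure under term contexts of the following rules ($y$ a variable, new bound variables fresh): - $(\lambda x.x)M\to M$; - $(\lambda x.M)V\to M[x:=V]$;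 - $\lambda x.Vx\to V$ ($x\notin FV(V)$); - $C[(\lambda x.M)N]\to(\lambda x.C[M])N$; - $C[yM]\to(\lambda x.C[x])(yM)$ if $C$ is not of the form $V[\,]$; - $(\lambda x.E[yx])M\to E[yM]$ if $x\notin FV(E[y])$; - $\mathbf{box}_x(M;x)\to M$; - $\mathbf{box}_{\vec w,x,\vec z}(\vec W,\mathbf{box}_{\vec y}(\vec N;V),\vec P;M)\to\mathbf{box}_{\vec w,\vec y,\vec z}(\vec W,\vec N,\vec P;M[x:=V])$, $\vec W$ values, $|\vec w|=|\vec W|$. $=_v$ and $=_n$ are the reflexive, symmetric, transitive closures of $\to_v$ and $\to_n$. Modified CPS transformation into the call-by-name calculus, with $R$ a fixed type constant and $k,h,y_i,z_i$ fresh variables. Types: - $p^\dagger=p$; - $(\sigma\supset\tau)^\dagger=(\tau^\dagger\supset R)\supset\sigma^\dagger\supset R$; - $(\Box\sigma)^\dagger=\Box((\sigma^\dagger\supset R)\supset R)$. Terms: - $[\![x]\!]^\dagger=\lambda k.kx$, $[\![c]\!]^\dagger=\lambda k.kc$; - $[\![\lambda x.M]\!]^\dagger=\lambda k.k(\lambda k'.\lambda x.[\![M]\!]^\dagger k')$; - $[\![MN]\!]^\dagger=\lambda k.[\![M]\!]^\dagger(\lambda y.[\![N]\!]^\dagger(yk))$; - $[\![\mathbf{box}_{\vec x}(\vec N;M)]\!]^\dagger=\lambda k.[\![\vec N]\!]^\dagger(\lambda\vec y.\,k(\mathbf{box}_{\vec z}(\vec y;\lambda h.\vec z(\lambda\vec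 x.[\![M]\!]^\dagger h))))$. *)

theory Defs
  imports Main
begin

datatype 'b ty = Atom 'b | Fun "'b ty" "'b ty" | Nec "'b ty"

text \<open>
  Terms modulo alpha-equivalence, as de Bruijn terms.  A pair \<open>(\<sigma>, N)\<close> in a \<open>Box\<close> is an argument
  together with the type annotation of the variable bound to it, so that
  \<open>Box [(\<sigma>\<^sub>0, N\<^sub>0), \<dots>, (\<sigma>\<^sub>m, N\<^sub>m)] M\<close> stands for a box with \<open>m + 1\<close> binders; in the body \<open>M\<close>, index \<open>i \<le> m\<close>
  refers to the variable paired with \<open>N\<^sub>i\<close> (left to right, all bound at once).
  No other variable may occur free in the body: see \<open>wf_tm\<close>.
\<close>

datatype ('b, 'c) tm =
    Cst 'c
  | Var nat
  | Lam "'b ty" "('b, 'c) tm"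
  | App "('b, 'c) tm" "('b, 'c) tm"
  | Box "('b ty \<times> ('b, 'c) tm) list" "('b, 'c) tm"

fun fv :: "('b, 'c) tm \<Rightarrow> nat set" where
  "fv (Cst c) = {}"
| "fv (Var i) = {i}"
| "fv (Lam \<sigma> M) = {i. Suc i \<in> fv M}"
| "fv (App M N) = fv M \<union> fv N"
| "fv (Box xs M) = (\<Union>(\<sigma>, N) \<in> set xs. fv N)"

text \<open>The proper terms: the free variables of every box body are among those bound by the box.\<close>

fun wf_tm :: "('b, 'c) tm \<Rightarrow> bool" where
  "wf_tm (Cst c) \<longleftrightarrow> True"
| "wf_tm (Var i) \<longleftrightarrow> True"
| "wf_tm (Lam \<sigma> M) \<longleftrightarrow> wf_tm M"
| "wf_tm (App M N) \<longleftrightarrow> wf_tm M \<and> wf_tm N"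
| "wf_tm (Box xs M) \<longleftrightarrow> (\<forall>(\<sigma>, N) \<in> set xs. wf_tm N) \<and> wf_tm M \<and> fv M \<subseteq> {..<length xs}"

text \<open>
  Renaming and simultaneous substitution do not enter box bodies, which have no free variables
  besides the ones bound by the box.
\<close>

fun ren :: "(nat \<Rightarrow> nat) \<Rightarrow> ('b, 'c) tm \<Rightarrow> ('b, 'c) tm" where
  "ren f (Cst c) = Cst c"
| "ren f (Var i) = Var (f i)"
| "ren f (Lam \<sigma> M) = Lam \<sigma> (ren (case_nat 0 (Suc \<circ> f)) M)"
| "ren f (App M N) = App (ren f M) (ren f N)"
| "ren f (Box xs M) = Box (map (\<lambda>(\<sigma>, N). (\<sigma>, ren f N)) xs) M"

abbreviation lift :: "('b, 'c) tm \<Rightarrow> ('b, 'c) tm" where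
  "lift \<equiv> ren Suc"

fun subst :: "(nat \<Rightarrow> ('b, 'c) tm) \<Rightarrow> ('b, 'c) tm \<Rightarrow> ('b, 'c) tm" where
  "subst s (Cst c) = Cst c"
| "subst s (Var i) = s i"
| "subst s (Lam \<sigma> M) = Lam \<sigma> (subst (case_nat (Var 0) (lift \<circ> s)) M)"
| "subst s (App M N) = App (subst s M) (subst s N)"
| "subst s (Box xs M) = Box (map (\<lambda>(\<sigma>, N). (\<sigma>, subst s N)) xs) M"

text \<open>\<open>M[x := N]\<close> for the outermost variable (index 0) of \<open>M\<close>.\<close>

definition inst :: "('b, 'c) tm \<Rightarrow> ('b, 'c) tm \<Rightarrow> ('b, 'c) tm" where
  "inst M N = subst (case_nat N Var) M"

text \<open>
  \<open>box_inst a b N M\<close> is \<open>M[x := N]\<close> for a box body \<open>M\<close> over the variables \<open>w, x, z\<close> and a box body \<open>N\<close>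
  over the variables \<open>y\<close> (with \<open>w\<close>, \<open>y\<close> of length \<open>a\<close>, \<open>b\<close>), as a box body over \<open>w, y, z\<close>.
\<close>

definition box_inst :: "nat \<Rightarrow> nat \<Rightarrow> ('b, 'c) tm \<Rightarrow> ('b, 'c) tm \<Rightarrow> ('b, 'c) tm" where
  "box_inst a b N M =
     subst (\<lambda>i. if i < a then Var i else if i = a then ren (\<lambda>j. a + j) N else Var (i - 1 + b)) M"

inductive ctx_closure ::
  "(('b, 'c) tm \<Rightarrow> ('b, 'c) tm \<Rightarrow> bool) \<Rightarrow> ('b, 'c) tm \<Rightarrow> ('b, 'c) tm \<Rightarrow> bool" for r where
  root: "r M N \<Longrightarrow> ctx_closure r M N"
| lam: "ctx_closure r M N \<Longrightarrow> ctx_closure r (Lam \<sigma> M) (Lam \<sigma> N)"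
| app_left: "ctx_closure r M N \<Longrightarrow> ctx_closure r (App M P) (App N P)"
| app_right: "ctx_closure r M N \<Longrightarrow> ctx_closure r (App P M) (App P N)"
| box_arg: "ctx_closure r M N \<Longrightarrow>
    ctx_closure r (Box (ps @ (\<sigma>, M) # qs) P) (Box (ps @ (\<sigma>, N) # qs) P)"
| box_body: "ctx_closure r M N \<Longrightarrow> ctx_closure r (Box ps M) (Box ps N)"

definition conversion ::
  "(('b, 'c) tm \<Rightarrow> ('b, 'c) tm \<Rightarrow> bool) \<Rightarrow> ('b, 'c) tm \<Rightarrow> ('b, 'c) tm \<Rightarrow> bool" where
  "conversion step = equivclp (\<lambda>M N. wf_tm M \<and> wf_tm N \<and> step M N)"

text \<open>As usual, \<open>lift M\<close> below a binder expresses that the bound variable is not free in \<open>M\<close>.\<close>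

inductive cbn_root :: "('b, 'c) tm \<Rightarrow> ('b, 'c) tm \<Rightarrow> bool" where
  beta: "cbn_root (App (Lam \<sigma> M) N) (inst M N)"
| eta: "cbn_root (Lam \<sigma> (App (lift M) (Var 0))) M"
| box_id: "cbn_root (Box [(\<sigma>, M)] (Var 0)) M"
| box_merge: "cbn_root
    (Box (ps @ (\<sigma>, Box ls N) # qs) M)
    (Box (ps @ ls @ qs) (box_inst (length ps) (length ls) N M))"

definition cbn_step :: "('b, 'c) tm \<Rightarrow> ('b, 'c) tm \<Rightarrow> bool" where
  "cbn_step = ctx_closure cbn_root"

definition cbn_eq :: "('b, 'c) tm \<Rightarrow> ('b, 'c) tm \<Rightarrow> bool"  (infix "=\<^sub>n" 50) where
  "cbn_eq = conversion cbn_step"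

fun is_val :: "('b, 'c) tm \<Rightarrow> bool" where
  "is_val (Cst c) \<longleftrightarrow> True"
| "is_val (Var i) \<longleftrightarrow> True"
| "is_val (Lam \<sigma> M) \<longleftrightarrow> True"
| "is_val (App M N) \<longleftrightarrow> False"
| "is_val (Box xs M) \<longleftrightarrow> (\<forall>(\<sigma>, N) \<in> set xs. is_val N)"

text \<open>
  Simple evaluation contexts are the frames satisfying \<open>simple\<close>; an evaluation context is a list of
  simple ones, outermost first.
\<close>

datatype ('b, 'c) frame =
    HoleApp "('b, 'c) tm"
  | AppHole "('b, 'c) tm"
  | BoxHole "('b ty \<times> ('b, 'c) tm) list" "'b ty" "('b ty \<times> ('b, 'c) tm) list" "('b, 'c) tm"

fun simple :: "('b, 'c) frame \<Rightarrow> bool" where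
  "simple (HoleApp M) \<longleftrightarrow> True"
| "simple (AppHole V) \<longleftrightarrow> is_val V"
| "simple (BoxHole ps \<sigma> qs M) \<longleftrightarrow> (\<forall>(\<tau>, V) \<in> set ps. is_val V)"

fun plug :: "('b, 'c) frame \<Rightarrow> ('b, 'c) tm \<Rightarrow> ('b, 'c) tm" where
  "plug (HoleApp M) P = App P M"
| "plug (AppHole V) P = App V P"
| "plug (BoxHole ps \<sigma> qs M) P = Box (ps @ (\<sigma>, P) # qs) M"

fun lift_frame :: "('b, 'c) frame \<Rightarrow> ('b, 'c) frame" where
  "lift_frame (HoleApp M) = HoleApp (lift M)"
| "lift_frame (AppHole V) = AppHole (lift V)"
| "lift_frame (BoxHole ps \<sigma> qs M) =
     BoxHole (map (\<lambda>(\<tau>, N). (\<tau>, lift N)) ps) \<sigma> (map (\<lambda>(\<tau>, N). (\<tau>, lift N)) qs) M"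

definition plugs :: "('b, 'c) frame list \<Rightarrow> ('b, 'c) tm \<Rightarrow> ('b, 'c) tm" where
  "plugs E P = foldr plug E P"

text \<open>
  In \<open>name_app\<close> the annotation of the new binder (the type of \<open>y M\<close>) is not determined by the
  term alone, so every annotation is admitted.
\<close>

inductive cbv_root :: "('b, 'c) tm \<Rightarrow> ('b, 'c) tm \<Rightarrow> bool" where
  beta_id: "cbv_root (App (Lam \<sigma> (Var 0)) M) M"
| beta_val: "is_val V \<Longrightarrow> cbv_root (App (Lam \<sigma> M) V) (inst M V)"
| eta_val: "is_val V \<Longrightarrow> cbv_root (Lam \<sigma> (App (lift V) (Var 0))) V"
| let_out: "simple C \<Longrightarrow> cbv_root
    (plug C (App (Lam \<sigma> M) N))
    (App (Lam \<sigma> (plug (lift_frame C) M)) N)"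
| name_app: "simple C \<Longrightarrow> (\<nexists>V. C = AppHole V) \<Longrightarrow> cbv_root
    (plug C (App (Var y) M))
    (App (Lam \<tau> (plug (lift_frame C) (Var 0))) (App (Var y) M))"
| unname_arg: "list_all simple E \<Longrightarrow> cbv_root
    (App (Lam \<sigma> (plugs (map lift_frame E) (App (Var (Suc y)) (Var 0)))) M)
    (plugs E (App (Var y) M))"
| box_id_val: "cbv_root (Box [(\<sigma>, M)] (Var 0)) M"
| box_merge_val: "(\<forall>(\<tau>, W) \<in> set ps. is_val W) \<Longrightarrow> is_val V \<Longrightarrow> cbv_root
    (Box (ps @ (\<sigma>, Box ls V) # qs) M)
    (Box (ps @ ls @ qs) (box_inst (length ps) (length ls) V M))"

definition cbv_step :: "('b, 'c) tm \<Rightarrow> ('b, 'c) tm \<Rightarrow> bool" where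
  "cbv_step = ctx_closure cbv_root"

definition cbv_eq :: "('b, 'c) tm \<Rightarrow> ('b, 'c) tm \<Rightarrow> bool"  (infix "=\<^sub>v" 50) where
  "cbv_eq = conversion cbv_step"

text \<open>\<open>neg R \<tau>\<close> is \<open>\<tau> \<supset> R\<close>.\<close>

abbreviation (input) neg :: "'b \<Rightarrow> 'b ty \<Rightarrow> 'b ty" where
  "neg R \<tau> \<equiv> Fun \<tau> (Atom R)"

fun dag :: "'b \<Rightarrow> 'b ty \<Rightarrow> 'b ty" where
  "dag R (Atom p) = Atom p"
| "dag R (Fun \<sigma> \<tau>) = Fun (neg R (dag R \<tau>)) (neg R (dag R \<sigma>))"
| "dag R (Nec \<sigma>) = Nec (neg R (neg R (dag R \<sigma>)))"

text \<open>
  The annotations of the binders introduced by the transformation depend on the types of the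
  subterms.  \<open>ty_of S G M\<close> is the type of \<open>M\<close>, where \<open>S\<close> and \<open>G\<close> give the types of the constants and
  of the free variables; it is a total function, with arbitrary values on terms that have no type.
\<close>

fun cod :: "'b ty \<Rightarrow> 'b ty" where
  "cod (Fun \<sigma> \<tau>) = \<tau>"
| "cod \<sigma> = \<sigma>"

fun ty_of :: "('c \<Rightarrow> 'b ty) \<Rightarrow> (nat \<Rightarrow> 'b ty) \<Rightarrow> ('b, 'c) tm \<Rightarrow> 'b ty" where
  "ty_of S G (Cst c) = S c"
| "ty_of S G (Var i) = G i"
| "ty_of S G (Lam \<sigma> M) = Fun \<sigma> (ty_of S (case_nat \<sigma> G) M)"
| "ty_of S G (App M N) = cod (ty_of S G M)"
| "ty_of S G (Box xs M) = Nec (ty_of S (nth (map fst xs)) M)"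

text \<open>
  \<open>binds 0 [(\<sigma>\<^sub>0, N\<^sub>0), \<dots>, (\<sigma>\<^sub>m, N\<^sub>m)] M\<close> is \<open>N\<^sub>0 (\<lambda>x\<^sub>0. \<dots> N\<^sub>m (\<lambda>x\<^sub>m. M) \<dots>)\<close>.  The \<open>N\<^sub>i\<close> are given in
  the context of the whole term; \<open>d\<close> counts the binders crossed since that context.
  In \<open>M\<close>, the variable \<open>x\<^sub>i\<close> has index \<open>m - i\<close>.
\<close>

fun binds :: "nat \<Rightarrow> ('b ty \<times> ('b, 'c) tm) list \<Rightarrow> ('b, 'c) tm \<Rightarrow> ('b, 'c) tm" where
  "binds d [] M = M"
| "binds d ((\<sigma>, N) # ps) M = App (ren (\<lambda>i. i + d) N) (Lam \<sigma> (binds (Suc d) ps M))"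

text \<open>
  In the box clause, \<open>n\<close> is the number of binders.  Below \<open>\<lambda>k\<close> and the \<open>\<lambda>y\<close>'s, \<open>k\<close> has index \<open>n\<close> and the
  \<open>i\<close>-th \<open>y\<close> has index \<open>n - 1 - i\<close>; inside the new box the \<open>i\<close>-th \<open>z\<close> has index \<open>i\<close>; below \<open>\<lambda>h\<close> and the
  \<open>\<lambda>x\<close>'s, \<open>h\<close> has index \<open>n\<close> and the \<open>i\<close>-th \<open>x\<close> (index \<open>i\<close> in \<open>M\<close>) has index \<open>n - 1 - i\<close>.
\<close>

fun cps :: "'b \<Rightarrow> ('c \<Rightarrow> 'b ty) \<Rightarrow> (nat \<Rightarrow> 'b ty) \<Rightarrow> ('b, 'c) tm \<Rightarrow> ('b, 'c) tm" where
  "cps R S G (Cst c) = Lam (neg R (dag R (S c))) (App (Var 0) (Cst c))"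
| "cps R S G (Var i) = Lam (neg R (dag R (G i))) (App (Var 0) (Var (Suc i)))"
| "cps R S G (Lam \<sigma> M) =
     (let G' = case_nat \<sigma> G; \<tau> = ty_of S G' M in
      Lam (neg R (dag R (Fun \<sigma> \<tau>)))
        (App (Var 0)
          (Lam (neg R (dag R \<tau>))
            (Lam (dag R \<sigma>)
              (App (ren (case_nat 0 (\<lambda>i. i + 3)) (cps R S G' M)) (Var 1))))))"
| "cps R S G (App M N) =
     Lam (neg R (dag R (ty_of S G (App M N))))
       (App (ren (\<lambda>i. i + 1) (cps R S G M))
         (Lam (dag R (ty_of S G M))
           (App (ren (\<lambda>i. i + 2) (cps R S G N)) (App (Var 0) (Var 1)))))"
| "cps R S G (Box xs M) =
     (let n = length xs; \<sigma> = nth (map fst xs); \<tau> = ty_of S \<sigma> M in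
      Lam (neg R (dag R (Nec \<tau>)))
        (binds 1 (map (\<lambda>(\<sigma>, N). (dag R (Nec \<sigma>), cps R S G N)) xs)
          (App (Var n)
            (Box (map (\<lambda>i. (neg R (neg R (dag R (\<sigma> i))), Var (n - 1 - i))) [0..<n])
              (Lam (neg R (dag R \<tau>))
                (binds 1 (map (\<lambda>i. (dag R (\<sigma> i), Var i)) [0..<n])
                  (App (ren (\<lambda>i. n - 1 - i) (cps R S \<sigma> M)) (Var n))))))))"

end

theory Submission
  imports Defs
begin

text \<open>
  On terms that need not be typed, type annotations are irrelevant for call-by-name conversion:
  \<open>\<lambda>x\<^sup>\<sigma>. (\<lambda>x\<^sup>\<tau>. M) x\<close> contracts by $\beta$ to \<open>\<lambda>x\<^sup>\<sigma>. M\<close> and by $\eta$ to \<open>\<lambda>x\<^sup>\<tau>. M\<close>, and the two box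
  rules do the same for the annotations in a box.  So the transformation can be computed without types.
  Then every value \<open>V\<close> has a translation \<open>vt V\<close> with \<open>\<lbrakk>V\<rbrakk> k = k (vt V)\<close>, every simple evaluation
  context \<open>C\<close> turns a continuation \<open>k\<close> into a continuation \<open>kk C k\<close> with \<open>\<lbrakk>C[M]\<rbrakk> k = \<lbrakk>M\<rbrakk> (kk C k)\<close>, and
  each call-by-value rule becomes a calculation with these two equations.
\<close>

section \<open>Renaming and substitution\<close>

abbreviation up :: "(nat \<Rightarrow> nat) \<Rightarrow> nat \<Rightarrow> nat" where
  "up f \<equiv> case_nat 0 (Suc \<circ> f)"

abbreviation ups :: "(nat \<Rightarrow> ('b, 'c) tm) \<Rightarrow> nat \<Rightarrow> ('b, 'c) tm" where
  "ups s \<equiv> case_nat (Var 0) (lift \<circ> s)"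

lemma ren_cong: "(\<And>i. i \<in> fv M \<Longrightarrow> f i = g i) \<Longrightarrow> ren f M = ren g M"
proof (induction M arbitrary: f g)
  case (Lam \<sigma> M)
  show ?case
    by (simp, rule Lam.IH) (use Lam.prems in \<open>auto split: nat.split\<close>)
next
  case (App M N)
  show ?case
    using App.IH(1)[of f g] App.IH(2)[of f g] App.prems by simp
next
  case (Box xs M)
  have "ren f N = ren g N" if "(\<sigma>, N) \<in> set xs" for \<sigma> N
    by (rule Box.IH(1)[OF that]) (use Box.prems that in auto)
  then show ?case
    by auto
qed simp_all

lemma subst_cong: "(\<And>i. i \<in> fv M \<Longrightarrow> s i = t i) \<Longrightarrow> subst s M = subst t M"
proof (induction M arbitrary: s t)
  case (Lam \<sigma> M)
  show ?case
    by (simp, rule Lam.IH) (use Lam.prems in \<open>auto split: nat.split\<close>)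
next
  case (App M N)
  show ?case
    using App.IH(1)[of s t] App.IH(2)[of s t] App.prems by simp
next
  case (Box xs M)
  have "subst s N = subst t N" if "(\<sigma>, N) \<in> set xs" for \<sigma> N
    by (rule Box.IH(1)[OF that]) (use Box.prems that in auto)
  then show ?case
    by auto
qed simp_all

lemma ren_eq_subst: "ren f M = subst (\<lambda>i. Var (f i)) M"
proof (induction M arbitrary: f)
  case (Lam \<sigma> M)
  show ?case
    by (simp add: Lam.IH) (rule subst_cong, simp split: nat.split)
qed auto

lemma subst_Var [simp]: "subst Var M = M"
proof (induction M)
  case (Lam \<sigma> M)
  have "case_nat (Var 0) (lift \<circ> Var) = (Var :: nat \<Rightarrow> ('a, 'b) tm)"
    by (rule ext) (simp split: nat.split)
  then show ?case
    using Lam by simp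
qed (auto intro!: map_idI)

lemma ren_id [simp]: "ren (\<lambda>i. i) = (\<lambda>M. M)"
  by (simp add: fun_eq_iff ren_eq_subst)

lemma ren_ren [simp]: "ren f (ren g M) = ren (\<lambda>i. f (g i)) M"
proof (induction M arbitrary: f g)
  case (Lam \<sigma> M)
  show ?case
    by (simp add: Lam.IH) (rule ren_cong, simp split: nat.split)
qed auto

lemma subst_ren [simp]: "subst s (ren g M) = subst (\<lambda>i. s (g i)) M"
proof (induction M arbitrary: s g)
  case (Lam \<sigma> M)
  show ?case
    by (simp add: Lam.IH) (rule subst_cong, simp split: nat.split)
qed auto

lemma ren_subst [simp]: "ren f (subst s M) = subst (\<lambda>i. ren f (s i)) M"
proof (induction M arbitrary: s f)
  case (Lam \<sigma> M)
  show ?case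
    by (simp add: Lam.IH) (rule subst_cong, simp split: nat.split)
qed auto

lemma subst_subst [simp]: "subst s (subst t M) = subst (\<lambda>i. subst s (t i)) M"
proof (induction M arbitrary: s t)
  case (Lam \<sigma> M)
  show ?case
    by (simp add: Lam.IH) (rule subst_cong, simp split: nat.split)
qed auto

lemma Suc_eq_case_nat: "Suc i = case_nat 0 f j \<longleftrightarrow> (\<exists>j'. j = Suc j' \<and> Suc i = f j')"
  by (cases j) auto

lemma fv_ren [simp]: "fv (ren f M) = f ` fv M"
proof (induction M arbitrary: f)
  case (Lam \<sigma> M)
  show ?case
    unfolding ren.simps fv.simps Lam.IH image_iff Suc_eq_case_nat by auto
qed (auto, fastforce)

lemma Suc_in_fv_ups: "Suc i \<in> fv (ups s j) \<longleftrightarrow> (\<exists>j'. j = Suc j' \<and> i \<in> fv (s j'))"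
  by (cases j) auto

lemma fv_subst: "fv (subst s M) = (\<Union>i\<in>fv M. fv (s i))"
proof (induction M arbitrary: s)
  case (Lam \<sigma> M)
  show ?case
    unfolding subst.simps fv.simps Lam.IH UN_iff Suc_in_fv_ups by auto
next
  case (Box xs M)
  have "fv (subst s (snd x)) = (\<Union>i\<in>fv (snd x). fv (s i))" if "x \<in> set xs" for x
    using Box.IH(1)[OF that] by (cases x) simp
  then show ?case
    by (auto simp: case_prod_beta)
qed auto

lemma wf_ren [simp]: "wf_tm (ren f M) \<longleftrightarrow> wf_tm M"
  by (induction M arbitrary: f) auto

lemma wf_subst: "wf_tm M \<Longrightarrow> (\<And>i. i \<in> fv M \<Longrightarrow> wf_tm (s i)) \<Longrightarrow> wf_tm (subst s M)"
proof (induction M arbitrary: s)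
  case (Lam \<sigma> M)
  show ?case
    by (simp, rule Lam.IH) (use Lam.prems in \<open>auto split: nat.split\<close>)
next
  case (Box xs M)
  have "wf_tm (subst s N)" if "(\<sigma>, N) \<in> set xs" for \<sigma> N
    by (rule Box.IH(1)[OF that]) (use Box.prems that in auto)
  then show ?case
    using Box.prems
    by auto
qed auto

lemma wf_inst: "wf_tm M \<Longrightarrow> wf_tm N \<Longrightarrow> wf_tm (inst M N)"
  unfolding inst_def by (rule wf_subst) (auto split: nat.split)

lemma finite_fv: "finite (fv M)"
proof (induction M)
  case (Lam \<sigma> M)
  have "{i. Suc i \<in> fv M} \<subseteq> (\<lambda>i. i - 1) ` fv M"
    by force
  then show ?case
    using Lam by (auto intro: finite_subset)
qed auto

lemma is_val_ren [simp]: "is_val (ren f M) \<longleftrightarrow> is_val M"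
  by (induction M arbitrary: f) auto

section \<open>Call-by-name conversion of proper terms\<close>

definition ceq :: "('b, 'c) tm \<Rightarrow> ('b, 'c) tm \<Rightarrow> bool"  (infix "\<simeq>" 50) where
  "M \<simeq> N \<longleftrightarrow> wf_tm M \<and> wf_tm N \<and> M =\<^sub>n N"

lemma ceq_refl: "wf_tm M \<Longrightarrow> M \<simeq> M"
  by (simp add: ceq_def cbn_eq_def conversion_def)

lemma ceq_sym: "M \<simeq> N \<Longrightarrow> N \<simeq> M"
  by (auto simp: ceq_def cbn_eq_def conversion_def intro: equivclp_sym)

lemma ceq_trans [trans]: "M \<simeq> N \<Longrightarrow> N \<simeq> P \<Longrightarrow> M \<simeq> P"
  by (auto simp: ceq_def cbn_eq_def conversion_def intro: equivclp_trans)

lemma ceq_wf: assumes "M \<simeq> N" shows "wf_tm M" "wf_tm N"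
  using assms by (auto simp: ceq_def)

lemma ceq_step: "cbn_step M N \<Longrightarrow> wf_tm M \<Longrightarrow> wf_tm N \<Longrightarrow> M \<simeq> N"
  by (auto simp: ceq_def cbn_eq_def conversion_def intro: r_into_equivclp)

lemma ceq_root: "cbn_root M N \<Longrightarrow> wf_tm M \<Longrightarrow> wf_tm N \<Longrightarrow> M \<simeq> N"
  by (rule ceq_step) (simp_all add: cbn_step_def ctx_closure.root)

lemma ceq_map:
  assumes "M \<simeq> N"
    and step: "\<And>M N. wf_tm M \<Longrightarrow> wf_tm N \<Longrightarrow> cbn_step M N \<Longrightarrow> F M \<simeq> F N"
    and wf: "\<And>M. wf_tm M \<Longrightarrow> wf_tm (F M)"
  shows "F M \<simeq> F N"
proof -
  have "equivclp (\<lambda>M N. wf_tm M \<and> wf_tm N \<and> cbn_step M N) M N" and "wf_tm M"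
    using assms(1) by (auto simp: ceq_def cbn_eq_def conversion_def)
  then show ?thesis
  proof (induction rule: equivclp_induct)
    case base
    then show ?case by (simp add: ceq_refl wf)
  next
    case (step P Q)
    then have "F P \<simeq> F Q"
      using assms(2) ceq_sym by blast
    with step show ?case
      by (blast intro: ceq_trans)
  qed
qed

lemma ceq_Lam: "M \<simeq> N \<Longrightarrow> Lam \<sigma> M \<simeq> Lam \<sigma> N"
  by (erule ceq_map) (auto intro!: ceq_step simp: cbn_step_def intro: ctx_closure.lam)

lemma ceq_App: assumes "M \<simeq> M'" "N \<simeq> N'" shows "App M N \<simeq> App M' N'"
proof -
  have "App M N \<simeq> App M' N"
    using assms(1) by (rule ceq_map[where F = "\<lambda>M. App M N"])
      (use ceq_wf[OF assms(2)] in \<open>auto intro!: ceq_step simp: cbn_step_def intro: ctx_closure.app_left\<close>)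
  also have "\<dots> \<simeq> App M' N'"
    using assms(2) by (rule ceq_map)
      (use ceq_wf[OF assms(1)] in \<open>auto intro!: ceq_step simp: cbn_step_def intro: ctx_closure.app_right\<close>)
  finally show ?thesis .
qed

lemma ceq_beta: "wf_tm M \<Longrightarrow> wf_tm N \<Longrightarrow> App (Lam \<sigma> M) N \<simeq> inst M N"
  by (rule ceq_root) (auto intro: cbn_root.beta wf_inst)

lemma ceq_eta: "wf_tm M \<Longrightarrow> Lam \<sigma> (App (lift M) (Var 0)) \<simeq> M"
  by (rule ceq_root) (auto intro: cbn_root.eta)

lemma wf_Box_merge:
  assumes "wf_tm (Box (ps @ (\<sigma>, Box ls N) # qs) M)"
  shows "wf_tm (Box (ps @ ls @ qs) (box_inst (length ps) (length ls) N M))"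
proof -
  let ?a = "length ps" and ?b = "length ls" and ?c = "length qs"
  have wfM: "wf_tm M" and M: "\<And>i. i \<in> fv M \<Longrightarrow> i < Suc (?a + ?c)"
    and wfN: "wf_tm N" and N: "\<And>i. i \<in> fv N \<Longrightarrow> i < ?b"
    using assms by auto
  have "wf_tm (box_inst ?a ?b N M)"
    unfolding box_inst_def by (rule wf_subst) (use wfM wfN in auto)
  moreover have "fv (box_inst ?a ?b N M) \<subseteq> {..<?a + (?b + ?c)}"
    by (auto simp: box_inst_def fv_subst dest!: N M split: if_splits)
  ultimately show ?thesis
    using assms by auto
qed

lemma ceq_box_merge:
  assumes "wf_tm (Box (ps @ (\<sigma>, Box ls N) # qs) M)"
  shows "Box (ps @ (\<sigma>, Box ls N) # qs) M \<simeq>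
    Box (ps @ ls @ qs) (box_inst (length ps) (length ls) N M)"
  using assms wf_Box_merge[OF assms] by (intro ceq_root cbn_root.box_merge)

lemma ceq_box_id: "wf_tm M \<Longrightarrow> Box [(\<sigma>, M)] (Var 0) \<simeq> M"
  by (rule ceq_root) (auto intro: cbn_root.box_id)

lemma ceq_Lam_annot: assumes "M \<simeq> N" shows "Lam \<sigma> M \<simeq> Lam \<tau> N"
proof -
  have wf: "wf_tm N"
    using assms ceq_wf by blast
  have inst: "inst (ren (up Suc) N) (Var 0) = N"
    unfolding inst_def subst_ren
    by (rule trans[OF subst_cong subst_Var]) (auto split: nat.split)
  have "Lam \<sigma> M \<simeq> Lam \<sigma> N"
    using assms by (rule ceq_Lam)
  also have "\<dots> \<simeq> Lam \<sigma> (App (lift (Lam \<tau> N)) (Var 0))"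
    by (rule ceq_Lam, rule ceq_sym) (use ceq_beta[of "ren (up Suc) N" "Var 0" \<tau>] wf inst in simp)
  also have "\<dots> \<simeq> Lam \<tau> N"
    using wf by (intro ceq_eta) simp
  finally show ?thesis .
qed

lemma ceq_Box_arg:
  assumes "M \<simeq> N" "wf_tm (Box (ps @ (\<sigma>, M) # qs) P)"
  shows "Box (ps @ (\<sigma>, M) # qs) P \<simeq> Box (ps @ (\<tau>, N) # qs) P"
proof -
  have arg: "Box (ps @ (\<sigma>, M) # qs) P \<simeq> Box (ps @ (\<sigma>, M') # qs) P" if "M \<simeq> M'" for M'
    using that by (rule ceq_map[where F = "\<lambda>M. Box (ps @ (\<sigma>, M) # qs) P"])
      (use assms in \<open>auto intro!: ceq_step simp: cbn_step_def intro: ctx_closure.box_arg\<close>)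
  have wf: "wf_tm N"
    using assms ceq_wf by blast
  have inst: "box_inst (length ps) (length [(\<tau>, N)]) (Var 0) P = P"
    unfolding box_inst_def
    by (rule trans[OF subst_cong subst_Var]) auto
  have "M \<simeq> Box [(\<tau>, N)] (Var 0)"
    by (rule ceq_trans[OF assms(1)], rule ceq_sym, rule ceq_box_id[OF wf])
  then have "Box (ps @ (\<sigma>, M) # qs) P \<simeq> Box (ps @ (\<sigma>, Box [(\<tau>, N)] (Var 0)) # qs) P"
    by (rule arg)
  also have "\<dots> \<simeq> Box (ps @ [(\<tau>, N)] @ qs) P"
    using ceq_box_merge[of ps \<sigma> "[(\<tau>, N)]" "Var 0" qs P] assms(2) wf inst by auto
  finally show ?thesis
    by simp
qed

lemma ceq_Box_args:
  assumes "list_all2 (\<lambda>x y. snd x \<simeq> snd y) xs ys" "wf_tm P" "fv P \<subseteq> {..<length ps + length xs}"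
    "\<forall>(\<sigma>, N)\<in>set ps. wf_tm N"
  shows "Box (ps @ xs) P \<simeq> Box (ps @ ys) P"
  using assms
proof (induction xs ys arbitrary: ps rule: list_all2_induct)
  case Nil
  then show ?case by (auto intro!: ceq_refl)
next
  case (Cons x xs y ys)
  obtain \<sigma> M \<tau> N where xy: "x = (\<sigma>, M)" "y = (\<tau>, N)"
    by fastforce
  have wf: "\<forall>x\<in>set xs. wf_tm (snd x)"
    using Cons.hyps(2) by induction (simp_all add: ceq_def)
  have MN: "M \<simeq> N"
    using Cons.hyps xy by simp
  have "Box (ps @ (\<sigma>, M) # xs) P \<simeq> Box (ps @ (\<tau>, N) # xs) P"
    by (rule ceq_Box_arg[OF MN]) (use Cons.prems wf ceq_wf[OF MN] in auto)
  also have "\<dots> \<simeq> Box (ps @ (\<tau>, N) # ys) P"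
    using Cons.IH[of "ps @ [(\<tau>, N)]"] Cons.prems ceq_wf[OF MN] by auto
  finally show ?case
    by (simp add: xy)
qed

lemma cbn_root_subst: "cbn_root M N \<Longrightarrow> cbn_root (subst s M) (subst s N)"
proof (induction rule: cbn_root.induct)
  case (beta \<sigma> M N)
  have "subst s (inst M N) = inst (subst (ups s) M) (subst s N)"
    by (simp add: inst_def) (rule subst_cong, simp split: nat.split)
  then show ?case
    by (simp add: cbn_root.beta)
next
  case (eta \<sigma> M)
  then show ?case
    using cbn_root.eta[of \<sigma> "subst s M"] by (simp add: comp_def)
next
  case (box_id \<sigma> M)
  then show ?case
    by (simp add: cbn_root.box_id)
next
  case (box_merge ps \<sigma> ls N qs M)
  then show ?case
    using cbn_root.box_merge[of "map (\<lambda>(\<sigma>, N). (\<sigma>, subst s N)) ps" \<sigma>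
        "map (\<lambda>(\<sigma>, N). (\<sigma>, subst s N)) ls" N "map (\<lambda>(\<sigma>, N). (\<sigma>, subst s N)) qs" M]
    by simp
qed

lemma cbn_step_subst: "cbn_step M N \<Longrightarrow> cbn_step (subst s M) (subst s N)"
  unfolding cbn_step_def
proof (induction arbitrary: s rule: ctx_closure.induct)
  case (root M N)
  then show ?case by (intro ctx_closure.root cbn_root_subst)
qed (simp_all add: ctx_closure.intros)

lemma ceq_subst: "M \<simeq> N \<Longrightarrow> (\<And>i. wf_tm (s i)) \<Longrightarrow> subst s M \<simeq> subst s N"
  by (erule ceq_map) (auto intro: ceq_step cbn_step_subst wf_subst)

lemma ceq_ren: "M \<simeq> N \<Longrightarrow> ren f M \<simeq> ren f N"
  by (simp add: ren_eq_subst ceq_subst)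

text \<open>
  A conversion between box bodies may pass through terms with further free variables; these are
  first replaced by a closed term.
\<close>

lemma ceq_Box_body:
  assumes "P \<simeq> Q" "wf_tm (Box xs P)" "fv Q \<subseteq> {..<length xs}"
  shows "Box xs P \<simeq> Box xs Q"
proof -
  define s :: "nat \<Rightarrow> ('a, 'b) tm" where
    "s i = (if i < length xs then Var i else Lam undefined (Var 0))" for i
  have id: "subst s M = M" if "fv M \<subseteq> {..<length xs}" for M
    by (rule trans[OF subst_cong subst_Var]) (use that in \<open>auto simp: s_def\<close>)
  have fv: "fv (subst s M) \<subseteq> {..<length xs}" for M
    by (auto simp: fv_subst s_def split: if_splits)
  have wf: "wf_tm (subst s M)" if "wf_tm M" for M
    by (rule wf_subst) (use that in \<open>auto simp: s_def\<close>)
  have "Box xs (subst s P) \<simeq> Box xs (subst s Q)"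
    using assms(1)
  proof (rule ceq_map)
    fix M N :: "('a, 'b) tm"
    assume "wf_tm M" "wf_tm N" "cbn_step M N"
    then show "Box xs (subst s M) \<simeq> Box xs (subst s N)"
      using assms(2) fv wf cbn_step_subst[of M N s]
      by (intro ceq_step) (auto simp: cbn_step_def intro: ctx_closure.box_body)
  next
    fix M :: "('a, 'b) tm"
    assume "wf_tm M"
    then show "wf_tm (Box xs (subst s M))"
      using assms(2) fv wf by auto
  qed
  then show ?thesis
    using id assms by simp
qed

lemma ceq_Box:
  assumes "list_all2 (\<lambda>x y. snd x \<simeq> snd y) xs ys" "P \<simeq> Q"
    "fv P \<subseteq> {..<length xs}" "fv Q \<subseteq> {..<length xs}"
  shows "Box xs P \<simeq> Box ys Q"
proof -
  have "Box xs P \<simeq> Box ys P"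
    using ceq_Box_args[of xs ys P "[]"] assms ceq_wf by auto
  also have "\<dots> \<simeq> Box ys Q"
    by (rule ceq_Box_body[OF assms(2) ceq_wf(2)[OF calculation]])
      (use assms list_all2_lengthD in fastforce)
  finally show ?thesis .
qed

text \<open>A fresh variable \<open>k\<close> suffices, so the extensionality rule needs no lifting.\<close>

lemma ceq_ext:
  assumes wf: "wf_tm A" "wf_tm B" and eq: "\<And>k. wf_tm k \<Longrightarrow> App A k \<simeq> App B k"
  shows "A \<simeq> B"
proof -
  obtain j where j: "j \<notin> fv A" "j \<notin> fv B"
    using ex_new_if_finite[of "fv A \<union> fv B"] by (auto simp: finite_fv)
  define f where "f i = (if i = j then 0 else Suc i)" for i
  have lift: "ren f M = lift M" if "j \<notin> fv M" for M :: "('a, 'b) tm"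
    by (rule ren_cong) (use that in \<open>auto simp: f_def\<close>)
  have "ren f (App A (Var j)) \<simeq> ren f (App B (Var j))"
    by (intro ceq_ren eq) simp
  then have "App (lift A) (Var 0) \<simeq> App (lift B) (Var 0)"
    using lift j by (simp add: f_def)
  then have "Lam undefined (App (lift A) (Var 0)) \<simeq> Lam undefined (App (lift B) (Var 0))"
    by (rule ceq_Lam)
  then show ?thesis
    by (rule ceq_trans[OF ceq_trans[OF ceq_sym[OF ceq_eta[OF wf(1)]]] ceq_eta[OF wf(2)]])
qed

section \<open>Sequential binding\<close>

abbreviation lam :: "('b, 'c) tm \<Rightarrow> ('b, 'c) tm" where
  "lam \<equiv> Lam undefined"

abbreviation bx :: "('b, 'c) tm list \<Rightarrow> ('b, 'c) tm \<Rightarrow> ('b, 'c) tm" where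
  "bx Ns M \<equiv> Box (map (Pair undefined) Ns) M"

function bnd :: "('b, 'c) tm list \<Rightarrow> ('b, 'c) tm \<Rightarrow> ('b, 'c) tm" where
  "bnd [] M = M"
| "bnd (N # Ns) M = App N (lam (bnd (map lift Ns) M))"
  by pat_completeness auto
termination
  by (relation "measure (length \<circ> fst)") auto

definition upn :: "nat \<Rightarrow> (nat \<Rightarrow> nat) \<Rightarrow> nat \<Rightarrow> nat" where
  "upn n f i = (if i < n then i else f (i - n) + n)"

definition upsn :: "nat \<Rightarrow> (nat \<Rightarrow> ('b, 'c) tm) \<Rightarrow> nat \<Rightarrow> ('b, 'c) tm" where
  "upsn n s i = (if i < n then Var i else ren (\<lambda>j. j + n) (s (i - n)))"

lemma ren_bnd [simp]: "ren f (bnd Ns M) = bnd (map (ren f) Ns) (ren (upn (length Ns) f) M)"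
proof (induction Ns M arbitrary: f rule: bnd.induct)
  case (1 M)
  then show ?case by (simp add: upn_def)
next
  case (2 N Ns M)
  have "ren (upn (length Ns) (up f)) M = ren (upn (Suc (length Ns)) f) M"
  proof (rule ren_cong)
    fix i
    show "upn (length Ns) (up f) i = upn (Suc (length Ns)) f i"
      by (cases "i - length Ns")
        (auto simp: upn_def not_less less_Suc_eq_le diff_Suc split: nat.split)
  qed
  then show ?case
    by (simp add: 2 comp_def)
qed

lemma subst_bnd [simp]: "subst s (bnd Ns M) = bnd (map (subst s) Ns) (subst (upsn (length Ns) s) M)"
proof (induction Ns M arbitrary: s rule: bnd.induct)
  case (1 M)
  then show ?case by (simp add: upsn_def)
next
  case (2 N Ns M)
  have "subst (upsn (length Ns) (ups s)) M = subst (upsn (Suc (length Ns)) s) M"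
  proof (rule subst_cong)
    fix i
    show "upsn (length Ns) (ups s) i = upsn (Suc (length Ns)) s i"
      by (cases "i - length Ns")
        (auto simp: upsn_def not_less less_Suc_eq_le diff_Suc split: nat.split)
  qed
  then show ?case
    by (simp add: 2 comp_def)
qed

lemma wf_bnd [simp]: "wf_tm (bnd Ns M) \<longleftrightarrow> (\<forall>N\<in>set Ns. wf_tm N) \<and> wf_tm M"
  by (induction Ns M rule: bnd.induct) auto

lemma fv_bnd [simp]: "fv (bnd Ns M) = (\<Union>N\<in>set Ns. fv N) \<union> {i. i + length Ns \<in> fv M}"
  by (induction Ns M rule: bnd.induct) auto

lemma bnd_append: "bnd (Ns @ Ms) M = bnd Ns (bnd (map (ren (\<lambda>i. i + length Ns)) Ms) M)"
proof (induction Ns M arbitrary: Ms rule: bnd.induct)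
  case (2 N Ns M)
  then show ?case
    using "2.IH"[of "map lift Ms"] by (simp add: comp_def)
qed simp

lemma ceq_bnd:
  "list_all2 (\<simeq>) Ns Ms \<Longrightarrow> M \<simeq> N \<Longrightarrow> bnd Ns M \<simeq> bnd Ms N"
proof (induction Ns M arbitrary: Ms rule: bnd.induct)
  case (2 K Ns M)
  then obtain L Ls where Ms: "Ms = L # Ls" "K \<simeq> L" "list_all2 (\<simeq>) Ns Ls"
    by (auto simp: list_all2_Cons1)
  then have "list_all2 (\<simeq>) (map lift Ns) (map lift Ls)"
    by (auto simp: list_all2_map1 list_all2_map2 intro: ceq_ren elim: list_all2_mono)
  then show ?case
    using 2 Ms by (auto intro!: ceq_App ceq_Lam)
qed simp

lemma ceq_bnd_body: "M \<simeq> N \<Longrightarrow> \<forall>N\<in>set Ns. wf_tm N \<Longrightarrow> bnd Ns M \<simeq> bnd Ns N"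
  by (rule ceq_bnd) (auto intro: list.rel_refl_strong ceq_refl)

definition vars :: "nat \<Rightarrow> ('b, 'c) tm list" where
  "vars n = map (\<lambda>i. Var (n - 1 - i)) [0..<n]"

lemma length_vars [simp]: "length (vars n) = n"
  by (simp add: vars_def)

lemma vars_add: "vars (m + n) = map (ren (\<lambda>i. i + n)) (vars m) @ vars n"
  by (rule nth_equalityI) (auto simp: vars_def nth_append)

lemma wf_vars: "N \<in> set (vars n) \<Longrightarrow> wf_tm N"
  by (auto simp: vars_def)

lemma fv_vars: "N \<in> set (vars n) \<Longrightarrow> i \<in> fv N \<Longrightarrow> i < n"
  by (auto simp: vars_def)

lemma ren_upn_vars [simp]: "map (\<lambda>x. (\<sigma>, ren (upn n f) x)) (vars n) = map (Pair \<sigma>) (vars n)"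
  by (auto simp: vars_def upn_def)

lemma subst_upsn_vars [simp]: "map (\<lambda>x. (\<sigma>, subst (upsn n s) x)) (vars n) = map (Pair \<sigma>) (vars n)"
  by (auto simp: vars_def upsn_def)

section \<open>The transformation without annotations\<close>

fun er :: "('b, 'c) tm \<Rightarrow> ('b, 'c) tm" where
  "er (Cst c) = Cst c"
| "er (Var i) = Var i"
| "er (Lam \<sigma> M) = lam (er M)"
| "er (App M N) = App (er M) (er N)"
| "er (Box xs M) = Box (map (\<lambda>(\<sigma>, N). (undefined, er N)) xs) (er M)"

lemma er_ren [simp]: "er (ren f M) = ren f (er M)"
  by (induction M arbitrary: f) auto

lemma fv_er [simp]: "fv (er M) = fv M"
proof (induction M)
  case (Box xs M)
  have "fv (er (snd x)) = fv (snd x)" if "x \<in> set xs" for x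
    using Box.IH(1)[OF that] by (cases x) simp
  then show ?case
    by (simp add: case_prod_beta)
qed auto

lemma wf_er [simp]: "wf_tm (er M) \<longleftrightarrow> wf_tm M"
  by (induction M) auto

lemma ceq_er: "wf_tm M \<Longrightarrow> M \<simeq> er M"
proof (induction M)
  case (Box xs M)
  have "snd x \<simeq> er (snd x)" if "x \<in> set xs" for x
    using Box.IH(1)[OF that] Box.prems that by (cases x) auto
  then have "list_all2 (\<lambda>x y. snd x \<simeq> snd y) xs (map (\<lambda>(\<sigma>, N). (undefined, er N)) xs)"
    by (auto simp: list_all2_map2 case_prod_beta intro!: list.rel_refl_strong)
  then show ?case
    using Box by (simp, intro ceq_Box) auto
qed (auto intro: ceq_refl ceq_App ceq_Lam_annot)

definition lam_val :: "('b, 'c) tm \<Rightarrow> ('b, 'c) tm" where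
  "lam_val P = lam (lam (App (ren (case_nat 0 (\<lambda>i. i + 2)) P) (Var 1)))"

definition box_body :: "nat \<Rightarrow> ('b, 'c) tm \<Rightarrow> ('b, 'c) tm" where
  "box_body n P =
     lam (bnd (map (\<lambda>i. Var (Suc i)) [0..<n]) (App (ren (\<lambda>i. n - 1 - i) P) (Var n)))"

fun cps0 :: "('b, 'c) tm \<Rightarrow> ('b, 'c) tm" where
  "cps0 (Cst c) = lam (App (Var 0) (Cst c))"
| "cps0 (Var i) = lam (App (Var 0) (Var (Suc i)))"
| "cps0 (Lam \<sigma> M) = lam (App (Var 0) (lift (lam_val (cps0 M))))"
| "cps0 (App M N) =
     lam (App (lift (cps0 M)) (lam (App (ren (\<lambda>i. i + 2) (cps0 N)) (App (Var 0) (Var 1)))))"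
| "cps0 (Box xs M) =
     lam (bnd (map (\<lambda>(\<sigma>, N). lift (cps0 N)) xs)
       (App (Var (length xs)) (bx (vars (length xs)) (box_body (length xs) (cps0 M)))))"

lemma er_binds:
  "er (binds d xs M) = bnd (map (\<lambda>(\<sigma>, N). ren (\<lambda>i. i + d) (er N)) xs) (er M)"
  by (induction d xs M rule: binds.induct) (simp_all add: comp_def case_prod_beta)

lemma er_cps: "er (cps R S G M) = cps0 M"
proof (induction M arbitrary: G)
  case (Lam \<sigma> M)
  show ?case
    by (simp add: Let_def Lam.IH lam_val_def) (rule ren_cong, simp split: nat.split)
next
  case (Box xs M)
  have "er (cps R S G (snd x)) = cps0 (snd x)" if "x \<in> set xs" for x
    using Box.IH(1)[OF that] by (cases x) simp
  then have args: "map (\<lambda>x. lift (er (cps R S G (snd x)))) xs = map (\<lambda>x. lift (cps0 (snd x))) xs"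
    by simp
  have rev: "ren ((-) (n - Suc 0)) P = ren (\<lambda>i. n - Suc i) P" for n and P :: "('a, 'b) tm"
    by (rule ren_cong) simp
  show ?case
    by (simp add: Let_def Box.IH er_binds box_body_def vars_def comp_def case_prod_beta' args rev)
qed (simp_all add: Let_def)

lemma wf_lam_val [simp]: "wf_tm (lam_val P) \<longleftrightarrow> wf_tm P"
  by (simp add: lam_val_def)

lemma wf_box_body [simp]: "wf_tm (box_body n P) \<longleftrightarrow> wf_tm P"
  by (auto simp: box_body_def)

lemma fv_lam_val [simp]: "fv (lam_val P) = {i. Suc i \<in> fv P}"
proof -
  have "Suc (Suc i) = case_nat 0 (\<lambda>i. Suc (Suc i)) j \<longleftrightarrow> j = Suc i" for i j
    by (cases j) auto
  then show ?thesis
    by (auto simp: lam_val_def image_iff)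
qed

lemma fv_box_body: "fv P \<subseteq> {..<n} \<Longrightarrow> fv (box_body n P) \<subseteq> {..<n}"
  by (auto simp: box_body_def)

lemma fv_cps0: "fv (cps0 M) \<subseteq> fv M"
proof (induction M)
  case (Box xs M)
  have "fv (cps0 (snd x)) \<subseteq> fv (snd x)" if "x \<in> set xs" for x
    using Box.IH(1)[OF that] by (cases x) simp
  then show ?case
    by (force simp: case_prod_beta dest: fv_vars)
qed auto

lemma wf_cps0: "wf_tm M \<Longrightarrow> wf_tm (cps0 M)"
proof (induction M)
  case (Box xs M)
  have "wf_tm (cps0 (snd x))" if "x \<in> set xs" for x
    using Box.IH(1)[OF that] Box.prems that by (cases x) auto
  moreover have "fv (box_body (length xs) (cps0 M)) \<subseteq> {..<length xs}"
    using Box.prems fv_cps0[of M] by (intro fv_box_body) auto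
  ultimately show ?case
    using Box by (auto simp: case_prod_beta wf_vars)
qed auto

lemma ren_lam_val [simp]: "ren f (lam_val P) = lam_val (ren (up f) P)"
  by (simp add: lam_val_def) (rule ren_cong, simp split: nat.split)

lemma cps0_ren: "cps0 (ren f M) = ren f (cps0 M)"
proof (induction M arbitrary: f)
  case (Lam \<sigma> M)
  then show ?case
    by (simp add: lam_val_def) (rule ren_cong, simp split: nat.split)
next
  case (Box xs M)
  have "cps0 (ren f (snd x)) = ren f (cps0 (snd x))" if "x \<in> set xs" for x
    using Box.IH(1)[OF that] by (cases x) simp
  then have args: "map (\<lambda>x. lift (cps0 (ren f (snd x)))) xs =
      map (\<lambda>x. ren (\<lambda>i. Suc (f i)) (cps0 (snd x))) xs"
    by simp
  show ?case
    by (simp add: case_prod_beta comp_def args) (simp add: upn_def)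
qed auto

lemma cps_ceq_cps0: "wf_tm M \<Longrightarrow> cps R S G M \<simeq> cps0 M"
  using ceq_er[of "cps R S G M"] wf_er[of "cps R S G M"] wf_cps0[of M] by (simp add: er_cps)

section \<open>Values\<close>

lemma wf_Box_iff [simp]: "wf_tm (Box xs M) \<longleftrightarrow>
    (\<forall>x\<in>set xs. wf_tm (snd x)) \<and> wf_tm M \<and> fv M \<subseteq> {..<length xs}"
  by auto

declare wf_tm.simps(5) [simp del]

text \<open>On values, \<open>vt\<close> is the value returned to the continuation; on applications it is junk.\<close>

fun vt :: "('b, 'c) tm \<Rightarrow> ('b, 'c) tm" where
  "vt (Cst c) = Cst c"
| "vt (Var i) = Var i"
| "vt (Lam \<sigma> M) = lam_val (cps0 M)"
| "vt (App M N) = App M N"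
| "vt (Box xs M) = bx (map (\<lambda>(\<sigma>, N). vt N) xs) (box_body (length xs) (cps0 M))"

lemma vt_ren: "vt (ren f M) = ren f (vt M)"
proof (induction M arbitrary: f)
  case (Box xs M)
  have "vt (ren f (snd x)) = ren f (vt (snd x))" if "x \<in> set xs" for x
    using Box.IH(1)[OF that] by (cases x) simp
  then show ?case
    by (simp add: case_prod_beta)
qed (simp_all add: cps0_ren)

lemma fv_vt: "fv (vt M) \<subseteq> fv M"
proof (induction M)
  case (Lam \<sigma> M)
  then show ?case
    using fv_cps0[of M] by auto
next
  case (Box xs M)
  have "fv (vt (snd x)) \<subseteq> fv (snd x)" if "x \<in> set xs" for x
    using Box.IH(1)[OF that] by (cases x) simp
  then show ?case
    by (force simp: case_prod_beta)
qed auto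

lemma wf_vt: "wf_tm M \<Longrightarrow> wf_tm (vt M)"
proof (induction M)
  case (Box xs M)
  have "wf_tm (vt (snd x))" if "x \<in> set xs" for x
    using Box.IH(1)[OF that] Box.prems that by (cases x) auto
  moreover have "fv (box_body (length xs) (cps0 M)) \<subseteq> {..<length xs}"
    using Box.prems fv_cps0[of M] by (intro fv_box_body) auto
  ultimately show ?case
    using Box.prems by (auto simp: case_prod_beta wf_cps0)
qed (auto simp: wf_cps0)

definition returns :: "('b, 'c) tm \<Rightarrow> ('b, 'c) tm \<Rightarrow> bool" where
  "returns N A \<longleftrightarrow> wf_tm N \<and> wf_tm A \<and> (\<forall>k. wf_tm k \<longrightarrow> App N k \<simeq> App k A)"

text \<open>In \<open>bnd Ns M\<close>, the variable bound to the \<open>i\<close>-th of \<open>n\<close> terms has index \<open>n - 1 - i\<close> in \<open>M\<close>.\<close>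

definition msub :: "('b, 'c) tm list \<Rightarrow> nat \<Rightarrow> ('b, 'c) tm" where
  "msub As i = (if i < length As then As ! (length As - 1 - i) else Var (i - length As))"

lemma wf_upsn: "(\<And>i. wf_tm (s i)) \<Longrightarrow> wf_tm (upsn n s i)"
  by (simp add: upsn_def)

lemma bnd_returns:
  assumes "list_all2 returns Ns As" "\<forall>N\<in>set Ms. wf_tm N" "wf_tm M"
  shows "bnd (Ns @ Ms) M \<simeq> bnd Ms (subst (upsn (length Ms) (msub As)) M)"
  using assms
proof (induction Ns As arbitrary: M rule: list_all2_induct)
  case Nil
  have "subst (upsn (length Ms) (msub [])) M = M"
    by (rule trans[OF subst_cong subst_Var]) (auto simp: upsn_def msub_def)
  then show ?case
    using Nil by (auto intro: ceq_refl)
next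
  case (Cons N Ns A As)
  let ?m = "length Ms" and ?n = "length Ns"
  have N: "wf_tm N" "wf_tm A" "\<And>k. wf_tm k \<Longrightarrow> App N k \<simeq> App k A"
    using Cons.hyps by (auto simp: returns_def)
  have Ns: "\<forall>N\<in>set Ns. wf_tm N" and len: "length As = ?n"
    using Cons.hyps(2) by (induction, auto simp: returns_def)
  define P where "P = subst (upsn (?n + ?m) (case_nat A Var)) M"
  have P: "wf_tm P"
    unfolding P_def by (rule wf_subst) (use Cons.prems N in \<open>auto intro!: wf_upsn split: nat.split\<close>)
  have inst: "inst (bnd (map lift (Ns @ Ms)) M) A = bnd (Ns @ Ms) P"
    by (simp add: inst_def P_def comp_def)
  have "App N (lam (bnd (map lift (Ns @ Ms)) M)) \<simeq> App (lam (bnd (map lift (Ns @ Ms)) M)) A"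
    by (rule N(3)) (use Ns Cons.prems in auto)
  also have "\<dots> \<simeq> inst (bnd (map lift (Ns @ Ms)) M) A"
    by (rule ceq_beta) (use Ns Cons.prems N in auto)
  also have "\<dots> = bnd (Ns @ Ms) P"
    by (rule inst)
  also have "\<dots> \<simeq> bnd Ms (subst (upsn ?m (msub As)) P)"
    using Cons P by blast
  also have "subst (upsn ?m (msub As)) P = subst (upsn ?m (msub (A # As))) M"
    unfolding P_def subst_subst
  proof (rule subst_cong)
    fix i
    consider "i < ?m" | "?m \<le> i" "i < ?n + ?m" | "i = ?n + ?m" | "i > ?n + ?m"
      by linarith
    then show "subst (upsn ?m (msub As)) (upsn (?n + ?m) (case_nat A Var) i) = upsn ?m (msub (A # As)) i"
    proof cases
      case 2
      then obtain l j where "i = ?m + l" "?n = Suc (l + j)"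
        using le_Suc_ex[of ?m i] less_iff_Suc_add[of i "?n + ?m"] by auto
      then show ?thesis
        by (simp add: upsn_def msub_def len)
    next
      case 3
      then show ?thesis
        by (simp add: upsn_def msub_def len ren_eq_subst)
    next
      case 4
      then obtain j where "i = Suc (?n + ?m + j)"
        using less_iff_Suc_add by blast
      then show ?thesis
        by (simp add: upsn_def msub_def len)
    qed (simp add: upsn_def)
  qed
  finally show ?case
    by simp
qed

lemma subst_msub_box:
  "subst (upsn m (msub As)) (App (ren (\<lambda>i. i + (length As + m)) k) (bx (vars (length As + m)) B)) =
    App (ren (\<lambda>i. i + m) k) (bx (map (ren (\<lambda>i. i + m)) As @ vars m) B)"
proof -
  have k: "subst (upsn m (msub As)) (ren (\<lambda>i. i + (length As + m)) k) = ren (\<lambda>i. i + m) k"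
    by (simp add: ren_eq_subst[of _ k]) (simp add: upsn_def msub_def)
  have args: "map (\<lambda>N. (undefined, subst (upsn m (msub As)) N)) (vars (length As + m)) =
      map (Pair undefined) (map (ren (\<lambda>i. i + m)) As @ vars m)"
    by (rule nth_equalityI)
      (auto simp: vars_def upsn_def msub_def nth_append)
  then show ?thesis
    using k by (simp add: comp_def)
qed

lemma cps0_Box:
  assumes "wf_tm (Box xs M)" "wf_tm k"
  shows "App (cps0 (Box xs M)) k \<simeq> bnd (map (\<lambda>x. cps0 (snd x)) xs)
    (App (ren (\<lambda>i. i + length xs) k) (bx (vars (length xs)) (box_body (length xs) (cps0 M))))"
proof -
  have k: "upsn (length xs) (case_nat k Var) (length xs) = ren (\<lambda>i. i + length xs) k"
    by (simp add: upsn_def)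
  have "wf_tm (cps0 (Box xs M))"
    using assms(1) by (rule wf_cps0)
  then have "App (cps0 (Box xs M)) k \<simeq> inst (bnd (map (\<lambda>(\<sigma>, N). lift (cps0 N)) xs)
       (App (Var (length xs)) (bx (vars (length xs)) (box_body (length xs) (cps0 M))))) k"
    unfolding cps0.simps by (intro ceq_beta assms) (simp only: wf_tm.simps)
  also have "\<dots> = bnd (map (\<lambda>x. cps0 (snd x)) xs)
    (App (ren (\<lambda>i. i + length xs) k) (bx (vars (length xs)) (box_body (length xs) (cps0 M))))"
    by (simp add: inst_def case_prod_beta' comp_def k)
  finally show ?thesis .
qed

lemma cps0_Box_returns:
  assumes "wf_tm (Box (ps @ qs) M)" "wf_tm k" "list_all2 returns (map (\<lambda>x. cps0 (snd x)) ps) As"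
  shows "App (cps0 (Box (ps @ qs) M)) k \<simeq> bnd (map (\<lambda>x. cps0 (snd x)) qs)
    (App (ren (\<lambda>i. i + length qs) k) (bx (map (ren (\<lambda>i. i + length qs)) As @ vars (length qs))
      (box_body (length ps + length qs) (cps0 M))))"
proof -
  have len: "length As = length ps"
    using assms(3) by (auto dest: list_all2_lengthD)
  have box: "fv (box_body (length ps + length qs) (cps0 M)) \<subseteq> {..<length ps + length qs}"
    using assms(1) fv_cps0[of M] by (intro fv_box_body) auto
  note cps0_Box[OF assms(1,2)]
  also have "bnd (map (\<lambda>x. cps0 (snd x)) (ps @ qs))
      (App (ren (\<lambda>i. i + length (ps @ qs)) k)
        (bx (vars (length (ps @ qs))) (box_body (length (ps @ qs)) (cps0 M)))) \<simeq>
    bnd (map (\<lambda>x. cps0 (snd x)) qs) (subst (upsn (length qs) (msub As))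
      (App (ren (\<lambda>i. i + (length As + length qs)) k)
        (bx (vars (length As + length qs)) (box_body (length ps + length qs) (cps0 M)))))"
    unfolding map_append length_append len[symmetric]
    using bnd_returns[OF assms(3), of "map (\<lambda>x. cps0 (snd x)) qs"
        "App (ren (\<lambda>i. i + (length As + length qs)) k)
          (bx (vars (length As + length qs)) (box_body (length ps + length qs) (cps0 M)))"]
      assms(1,2) box by (auto simp: len wf_cps0 wf_vars)
  finally show ?thesis
    by (simp only: subst_msub_box)
qed

lemma returns_vt: "is_val V \<Longrightarrow> wf_tm V \<Longrightarrow> returns (cps0 V) (vt V)"
proof (induction V)
  case (Lam \<sigma> M)
  have "App (cps0 (Lam \<sigma> M)) k \<simeq> App k (lam_val (cps0 M))" if "wf_tm k" for k
    using ceq_beta[of "App (Var 0) (lift (lam_val (cps0 M)))" k] Lam.prems that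
    by (simp add: inst_def wf_cps0 del: ren_lam_val)
  then show ?case
    using Lam.prems by (simp add: returns_def wf_cps0)
next
  case (Box xs M)
  have "returns (cps0 (snd x)) (vt (snd x))" if "x \<in> set xs" for x
  proof -
    have "is_val (snd x)" "wf_tm (snd x)"
      using Box.prems that by (auto simp: case_prod_beta)
    then show ?thesis
      using Box.IH(1)[OF that] by (cases x) simp
  qed
  then have vals: "list_all2 returns (map (\<lambda>x. cps0 (snd x)) xs) (map (\<lambda>x. vt (snd x)) xs)"
    by (auto simp: list_all2_map1 list_all2_map2 intro: list.rel_refl_strong)
  have "App (cps0 (Box xs M)) k \<simeq> App k (vt (Box xs M))" if "wf_tm k" for k
    using cps0_Box_returns[of xs "[]" M k, OF _ that vals] Box.prems
    by (simp add: vars_def comp_def case_prod_beta')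
  then show ?case
    using wf_cps0[OF Box.prems(2)] wf_vt[OF Box.prems(2)] by (simp add: returns_def del: cps0.simps vt.simps)
next
  case (Cst c)
  then show ?case
    by (auto simp: returns_def inst_def intro!: ceq_beta[THEN ceq_trans] ceq_refl)
next
  case (Var i)
  then show ?case
    by (auto simp: returns_def inst_def intro!: ceq_beta[THEN ceq_trans] ceq_refl)
qed simp

lemma cps0_val: "is_val V \<Longrightarrow> wf_tm V \<Longrightarrow> wf_tm k \<Longrightarrow> App (cps0 V) k \<simeq> App k (vt V)"
  using returns_vt by (auto simp: returns_def)

section \<open>Evaluation contexts as continuations\<close>

lemma cps0_App:
  assumes "wf_tm M" "wf_tm N" "wf_tm k"
  shows "App (cps0 (App M N)) k \<simeq> App (cps0 M) (lam (App (lift (cps0 N)) (App (Var 0) (lift k))))"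
  using assms ceq_beta[of "App (lift (cps0 M)) (lam (App (ren (\<lambda>i. i + 2) (cps0 N)) (App (Var 0) (Var 1))))"
      k undefined]
  by (simp add: inst_def wf_cps0 ren_eq_subst[of Suc "cps0 N"] ren_eq_subst[of Suc k])

lemma cps0_App_val:
  assumes "is_val V" "wf_tm V" "wf_tm M" "wf_tm k"
  shows "App (cps0 (App V M)) k \<simeq> App (cps0 M) (App (vt V) k)"
proof -
  let ?K = "App (lift (cps0 M)) (App (Var 0) (lift k))"
  have "App (cps0 (App V M)) k \<simeq> App (cps0 V) (lam ?K)"
    using assms by (intro cps0_App)
  also have "\<dots> \<simeq> App (lam ?K) (vt V)"
    using assms by (intro cps0_val) (auto simp: wf_cps0)
  also have "\<dots> \<simeq> inst ?K (vt V)"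
    using assms by (intro ceq_beta) (auto simp: wf_cps0 wf_vt)
  finally show ?thesis
    by (simp add: inst_def)
qed

lemma cps0_let:
  assumes "wf_tm M" "wf_tm N" "wf_tm k"
  shows "App (cps0 (App (Lam \<sigma> M) N)) k \<simeq> App (cps0 N) (lam (App (cps0 M) (lift k)))"
proof -
  let ?P = "lam (App (ren (case_nat 0 (\<lambda>i. i + 2)) (cps0 M)) (Var 1))"
  have inst: "inst ?P k = lam (App (cps0 M) (lift k))"
    by (simp add: inst_def)
      (rule trans[OF subst_cong subst_Var], simp split: nat.split)
  have "App (cps0 (App (Lam \<sigma> M) N)) k \<simeq> App (cps0 N) (App (lam ?P) k)"
    using cps0_App_val[of "Lam \<sigma> M" N k] assms by (simp add: lam_val_def del: cps0.simps)
  also have "\<dots> \<simeq> App (cps0 N) (inst ?P k)"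
    using assms by (intro ceq_App ceq_refl ceq_beta) (auto simp: wf_cps0)
  finally show ?thesis
    by (simp only: inst)
qed

fun kk :: "('b, 'c) frame \<Rightarrow> ('b, 'c) tm \<Rightarrow> ('b, 'c) tm" where
  "kk (HoleApp N) k = lam (App (lift (cps0 N)) (App (Var 0) (lift k)))"
| "kk (AppHole V) k = App (vt V) k"
| "kk (BoxHole ps \<sigma> qs M) k = (let m = Suc (length qs) in
     lam (bnd (map (\<lambda>x. lift (cps0 (snd x))) qs)
       (App (ren (\<lambda>i. i + m) k) (bx (map (\<lambda>x. ren (\<lambda>i. i + m) (vt (snd x))) ps @ vars m)
         (box_body (length ps + m) (cps0 M))))))"

lemma wf_plugD: "wf_tm (plug C M) \<Longrightarrow> wf_tm M"
  by (cases C) auto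

lemma wf_plug_lift: "wf_tm (plug C M) \<Longrightarrow> wf_tm N \<Longrightarrow> wf_tm (plug (lift_frame C) N)"
  by (cases C) (simp_all add: case_prod_beta ball_Un)

lemma simple_lift: "simple C \<Longrightarrow> simple (lift_frame C)"
  by (cases C) auto

lemma lift_kk: "lift (kk C k) = kk (lift_frame C) (lift k)"
proof (cases C)
  case (HoleApp N)
  then show ?thesis
    by (simp add: cps0_ren)
next
  case (AppHole V)
  then show ?thesis
    by (simp add: vt_ren)
next
  case (BoxHole ps \<sigma> qs M)
  let ?m = "Suc (length qs)"
  have up: "upn (length qs) (case_nat 0 (\<lambda>i. Suc (Suc i))) = upn ?m Suc"
    by (auto simp: fun_eq_iff upn_def diff_Suc split: nat.split)
  have vars: "map (\<lambda>x. (undefined, ren (upn ?m Suc) x)) (vars ?m) = map (Pair undefined) (vars ?m)"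
    by (rule ren_upn_vars)
  show ?thesis
    using vars by (simp add: BoxHole Let_def comp_def cps0_ren vt_ren case_prod_beta')
      (simp add: up, simp add: upn_def)
qed

lemma cps0_plug:
  assumes "simple C" "wf_tm (plug C M)" "wf_tm k"
  shows "App (cps0 (plug C M)) k \<simeq> App (cps0 M) (kk C k)"
proof (cases C)
  case (HoleApp N)
  then show ?thesis
    using cps0_App assms by auto
next
  case (AppHole V)
  then show ?thesis
    using cps0_App_val assms by auto
next
  case (BoxHole ps \<sigma> qs P)
  have "returns (cps0 (snd x)) (vt (snd x))" if "x \<in> set ps" for x
    using assms that BoxHole by (intro returns_vt) auto
  then have vals: "list_all2 returns (map (\<lambda>x. cps0 (snd x)) ps) (map (\<lambda>x. vt (snd x)) ps)"
    by (auto simp: list_all2_map1 list_all2_map2 intro: list.rel_refl_strong)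
  show ?thesis
    using cps0_Box_returns[of ps "(\<sigma>, M) # qs" P k, OF _ assms(3) vals] assms(2)
    by (simp add: BoxHole Let_def comp_def)
qed

lemma cps0_plugs:
  assumes "list_all simple E" "wf_tm (plugs E M)" "wf_tm k"
  shows "App (cps0 (plugs E M)) k \<simeq> App (cps0 M) (fold kk E k)"
  using assms
proof (induction E arbitrary: k)
  case Nil
  then show ?case
    by (simp add: plugs_def ceq_refl wf_cps0)
next
  case (Cons C E)
  then have wf: "wf_tm (plug C (plugs E M))"
    by (simp add: plugs_def)
  have "App (cps0 (plug C (plugs E M))) k \<simeq> App (cps0 (plugs E M)) (kk C k)"
    using Cons.prems wf by (intro cps0_plug) auto
  moreover from ceq_wf(2)[OF this] have "App (cps0 (plugs E M)) (kk C k) \<simeq> App (cps0 M) (fold kk E (kk C k))"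
    using Cons.prems wf_plugD[OF wf] by (intro Cons.IH) auto
  ultimately have "App (cps0 (plug C (plugs E M))) k \<simeq> App (cps0 M) (fold kk E (kk C k))"
    by (rule ceq_trans)
  then show ?case
    by (simp add: plugs_def)
qed

lemma lift_fold_kk: "lift (fold kk E k) = fold kk (map lift_frame E) (lift k)"
  by (induction E arbitrary: k) (simp_all add: lift_kk)

section \<open>Substitution of values\<close>

lemma ceq_lam_val: "P \<simeq> Q \<Longrightarrow> lam_val P \<simeq> lam_val Q"
  unfolding lam_val_def by (intro ceq_Lam ceq_App ceq_ren ceq_refl) simp_all

lemma ceq_box_body: "P \<simeq> Q \<Longrightarrow> box_body n P \<simeq> box_body n Q"
  unfolding box_body_def by (intro ceq_Lam ceq_bnd_body ceq_App ceq_ren ceq_refl) simp_all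

lemma subst_lam_val [simp]: "subst s (lam_val P) = lam_val (subst (ups s) P)"
  by (simp add: lam_val_def) (rule subst_cong, simp split: nat.split add: comp_def)

lemma cps0_subst:
  assumes "wf_tm M" "\<And>i. is_val (s i)" "\<And>i. wf_tm (s i)"
  shows "cps0 (subst s M) \<simeq> subst (\<lambda>i. vt (s i)) (cps0 M)"
  using assms
proof (induction M arbitrary: s)
  case (Cst c)
  then show ?case by (simp add: ceq_refl)
next
  case (Var i)
  let ?A = "lam (App (Var 0) (lift (vt (s i))))"
  have "cps0 (s i) \<simeq> ?A"
  proof (rule ceq_ext)
    fix k :: "('a, 'b) tm"
    assume k: "wf_tm k"
    have "App (cps0 (s i)) k \<simeq> App k (vt (s i))"
      using Var k by (intro cps0_val)
    also have "\<dots> \<simeq> App ?A k"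
      using Var k by (auto simp: inst_def wf_vt intro!: ceq_sym[OF ceq_beta[THEN ceq_trans]] ceq_refl)
    finally show "App (cps0 (s i)) k \<simeq> App ?A k" .
  qed (use Var in \<open>auto simp: wf_cps0 wf_vt\<close>)
  then show ?case by simp
next
  case (Lam \<sigma> M)
  have "(\<lambda>i. vt (ups s i)) = ups (\<lambda>i. vt (s i))"
    by (auto simp: fun_eq_iff vt_ren split: nat.split)
  moreover have "cps0 (subst (ups s) M) \<simeq> subst (\<lambda>i. vt (ups s i)) (cps0 M)"
    using Lam.prems by (intro Lam.IH) (auto split: nat.split)
  ultimately have "cps0 (subst (ups s) M) \<simeq> subst (ups (\<lambda>i. vt (s i))) (cps0 M)"
    by simp
  then have "lam (App (Var 0) (lift (lam_val (cps0 (subst (ups s) M))))) \<simeq>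
      lam (App (Var 0) (lift (lam_val (subst (ups (\<lambda>i. vt (s i))) (cps0 M)))))"
    by (intro ceq_Lam ceq_App ceq_ren ceq_refl ceq_lam_val) simp_all
  also have "lam (App (Var 0) (lift (lam_val (subst (ups (\<lambda>i. vt (s i))) (cps0 M))))) =
      subst (\<lambda>i. vt (s i)) (cps0 (Lam \<sigma> M))"
    by (simp del: ren_lam_val subst_lam_val add: subst_lam_val[symmetric])
  finally show ?case by simp
next
  case (App M N)
  let ?t = "\<lambda>i. vt (s i)"
  have "cps0 (subst s (App M N)) \<simeq>
      lam (App (lift (subst ?t (cps0 M)))
        (lam (App (ren (\<lambda>i. i + 2) (subst ?t (cps0 N))) (App (Var 0) (Var 1)))))"
    unfolding subst.simps cps0.simps using App
    by (intro ceq_Lam ceq_App ceq_ren ceq_refl) auto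
  then show ?case
    by (simp add: comp_def)
next
  case (Box xs M)
  let ?t = "\<lambda>i. vt (s i)" and ?n = "length xs"
  let ?B = "App (Var ?n) (bx (vars ?n) (box_body ?n (cps0 M)))"
  have IH: "cps0 (subst s (snd x)) \<simeq> subst ?t (cps0 (snd x))" if "x \<in> set xs" for x
    using Box.IH(1)[OF that, of "snd x" s] Box.prems that by (cases x) auto
  have "wf_tm (cps0 (Box xs M))"
    using Box.prems by (intro wf_cps0)
  then have "wf_tm ?B"
    by simp
  then have "lam (bnd (map (\<lambda>x. lift (cps0 (subst s (snd x)))) xs) ?B) \<simeq>
      lam (bnd (map (\<lambda>x. lift (subst ?t (cps0 (snd x)))) xs) ?B)"
    using IH by (intro ceq_Lam ceq_bnd ceq_refl)
      (auto simp: list_all2_map1 list_all2_map2 simp del: ren_subst intro!: list.rel_refl_strong ceq_ren)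
  moreover have "upsn ?n (ups ?t) ?n = Var ?n"
    by (simp add: upsn_def)
  ultimately show ?case
    by (simp add: case_prod_beta' comp_def)
qed

lemma cps0_inst:
  assumes "is_val V" "wf_tm V" "wf_tm M"
  shows "cps0 (inst M V) \<simeq> inst (cps0 M) (vt V)"
proof -
  have "(\<lambda>i. vt (case_nat V Var i)) = case_nat (vt V) Var"
    by (auto simp: fun_eq_iff split: nat.split)
  then show ?thesis
    using cps0_subst[of M "case_nat V Var"] assms by (simp add: inst_def split: nat.split)
qed

section \<open>Merging boxes\<close>

lemma box_body_beta:
  assumes "wf_tm P" "fv P \<subseteq> {..<b}" "wf_tm K"
  shows "App (ren f (box_body b P)) K \<simeq>
    bnd (map (\<lambda>i. Var (f i)) [0..<b]) (App (ren (\<lambda>i. b - 1 - i) P) (ren (\<lambda>i. i + b) K))"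
proof -
  let ?B = "bnd (map (\<lambda>i. Var (Suc i)) [0..<b]) (App (ren (\<lambda>i. b - 1 - i) P) (Var b))"
  have P: "subst (\<lambda>i. upsn b (case_nat K Var) (upn b (up f) (b - Suc i))) P = ren (\<lambda>i. b - Suc i) P"
    unfolding ren_eq_subst
    by (rule subst_cong) (use assms(2) in \<open>auto simp: upsn_def upn_def\<close>)
  have K: "upsn b (case_nat K Var) (upn b (up f) b) = ren (\<lambda>i. i + b) K"
    by (simp add: upsn_def upn_def)
  have "App (lam (ren (up f) ?B)) K \<simeq> inst (ren (up f) ?B) K"
    by (rule ceq_beta) (use assms in auto)
  also have "inst (ren (up f) ?B) K =
      bnd (map (\<lambda>i. Var (f i)) [0..<b]) (App (ren (\<lambda>i. b - 1 - i) P) (ren (\<lambda>i. i + b) K))"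
    using P K by (simp add: inst_def comp_def)
  finally show ?thesis
    by (simp add: box_body_def)
qed

lemma box_body_merge:
  fixes V M :: "('b, 'c) tm"
  assumes V: "is_val V" "wf_tm V" "fv V \<subseteq> {..<b}"
    and M: "wf_tm M" "fv M \<subseteq> {..<Suc (a + c)}"
  shows "box_inst a b (box_body b (cps0 V)) (box_body (Suc (a + c)) (cps0 M)) \<simeq>
    box_body (a + b + c) (cps0 (box_inst a b V M))"
proof -
  define g :: "nat \<Rightarrow> nat \<Rightarrow> ('b, 'c) tm list" where
    "g d m = map (\<lambda>i. Var (i + d)) [0..<m]" for d m
  have len [simp]: "length (g d m) = m" for d m
    by (simp add: g_def)
  have g_add: "g d (m + m') = g d m @ g (d + m) m'" for d m m'
    by (rule nth_equalityI) (auto simp: g_def nth_append)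
  have ren_g [simp]: "map (ren (\<lambda>i. i + e)) (g d m) = g (d + e) m" for d e m
    by (simp add: g_def)
  have lift_g [simp]: "map lift (g d m) = g (Suc d) m" for d m
    by (simp add: g_def)
  have wf_g: "\<forall>N\<in>set (g d m). wf_tm N" for d m
    by (auto simp: g_def)
  let ?n = "Suc (a + c)" and ?N = "a + b + c"
  define s where "s W i = (if i < a then Var i else if i = a then ren (\<lambda>j. a + j) W else Var (i - 1 + b))"
    for W :: "('b, 'c) tm" and i
  define Q where "Q = subst (s (vt V)) (cps0 M)"
  have fvVM: "i < b" if "i \<in> fv (vt V)" for i
    using that fv_vt[of V] V by auto
  have fvM: "i < ?n" if "i \<in> fv (cps0 M)" for i
    using that fv_cps0[of M] M by auto
  have vt_s: "(\<lambda>i. vt (s V i)) = s (vt V)"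
    by (auto simp: fun_eq_iff s_def vt_ren)
  have box_inst_s: "box_inst a b W P = subst (s W) P" for W P
    by (simp add: box_inst_def s_def[abs_def])
  have "is_val (s V i)" "wf_tm (s V i)" for i
    using V by (simp_all add: s_def)
  then have Q: "cps0 (box_inst a b V M) \<simeq> Q"
    using cps0_subst[of M "s V"] M by (simp add: box_inst_s Q_def vt_s)
  define Z where "Z = App (ren (\<lambda>i. a + c - i) (cps0 M)) (Var ?n)"
  define X where "X = lam (bnd (g (Suc (a + b) + Suc a) c) Z)"
  define Z' where "Z' = App (ren (\<lambda>i. ?N - 1 - i) Q) (Var ?N)"
  have wfX: "wf_tm X" and wfZ: "wf_tm Z"
    using M wf_g by (auto simp: X_def Z_def wf_cps0)

  have Zs: "subst (upsn ?n (ups (s W))) Z = Z" for W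
  proof -
    have "subst (\<lambda>i. upsn ?n (ups (s W)) (a + c - i)) (cps0 M) = ren (\<lambda>i. a + c - i) (cps0 M)"
      unfolding ren_eq_subst by (rule subst_cong) (auto simp: upsn_def)
    then show ?thesis
      by (simp add: Z_def) (simp add: upsn_def)
  qed
  have args: "map (\<lambda>i. lift (s W i)) [0..<?n] = g 1 a @ (ren (\<lambda>j. Suc (a + j)) W # g (Suc (a + b)) c)" for W
    by (rule nth_equalityI) (auto simp: g_def s_def nth_append nth_Cons less_Suc_eq split: nat.split)
  have "box_inst a b (box_body b (cps0 V)) (box_body ?n (cps0 M)) =
      lam (bnd (map (\<lambda>i. lift (s (box_body b (cps0 V)) i)) [0..<?n]) Z)"
    using Zs[of "box_body b (cps0 V)"]
    by (simp add: box_inst_s box_body_def[of ?n] Z_def comp_def del: upt_Suc)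
  also have "\<dots> = lam (bnd (g 1 a) (App (ren (\<lambda>i. i + Suc (a + a)) (box_body b (cps0 V))) X))"
    unfolding args bnd_append by (simp add: X_def comp_def add_ac)
  also have "\<dots> \<simeq> lam (bnd (g 1 a) (bnd (g (Suc (a + a)) b)
      (App (cps0 (ren (\<lambda>i. b - 1 - i) V)) (ren (\<lambda>i. i + b) X))))"
    using box_body_beta[of "cps0 V" b X "\<lambda>i. i + Suc (a + a)"] V fv_cps0[of V] wfX
    by (intro ceq_Lam ceq_bnd_body wf_g) (auto simp: g_def cps0_ren wf_cps0)
  also have "\<dots> \<simeq> lam (bnd (g 1 a) (bnd (g (Suc (a + a)) b)
      (App (ren (\<lambda>i. i + b) X) (ren (\<lambda>i. b - 1 - i) (vt V)))))"
    using V wfX unfolding vt_ren[symmetric] by (intro ceq_Lam ceq_bnd_body wf_g cps0_val) simp_all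
  also have "\<dots> \<simeq> lam (bnd (g 1 a) (bnd (g (Suc (a + a)) b)
      (bnd (g (Suc (a + b) + (a + b)) c) Z')))"
  proof (intro ceq_Lam ceq_bnd_body wf_g)
    let ?A = "ren (\<lambda>i. b - 1 - i) (vt V)"
    let ?Y = "ren (up (\<lambda>i. i + b)) (bnd (g (Suc (a + b) + Suc a) c) Z)"
    have "App (ren (\<lambda>i. i + b) X) ?A \<simeq> inst ?Y ?A"
      unfolding X_def ren.simps by (rule ceq_beta) (use V wfZ wf_g in \<open>auto simp: wf_vt\<close>)
    also have "inst ?Y ?A = bnd (g (Suc (a + b) + (a + b)) c)
        (subst (\<lambda>i. upsn c (case_nat ?A Var) (upn c (up (\<lambda>i. i + b)) i)) Z)"
      by (simp add: inst_def g_def comp_def add_ac)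
    also have "subst (\<lambda>i. upsn c (case_nat ?A Var) (upn c (up (\<lambda>i. i + b)) i)) Z = Z'"
    proof -
      have index: "upsn c (case_nat ?A Var) (upn c (up (\<lambda>i. i + b)) (a + c - i)) =
          ren (\<lambda>i. ?N - 1 - i) (s (vt V) i)" if "i < ?n" for i
      proof -
        consider "i < a" | "i = a" | "i > a"
          by linarith
        then show ?thesis
        proof cases
          case 1
          then obtain j where "a = Suc (i + j)"
            using less_iff_Suc_add by blast
          then show ?thesis
            by (simp add: s_def upsn_def upn_def)
        next
          case 2
          have "ren (\<lambda>i. b - Suc i + c) (vt V) = ren (\<lambda>j. a + b + c - Suc (a + j)) (vt V)"
            by (rule ren_cong) (auto dest: fvVM)
          then show ?thesis
            using 2 by (simp add: s_def upsn_def upn_def)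
        next
          case 3
          then show ?thesis
            using that by (auto simp: s_def upsn_def upn_def)
        qed
      qed
      have "subst (\<lambda>i. upsn c (case_nat ?A Var) (upn c (up (\<lambda>i. i + b)) (a + c - i))) (cps0 M) =
          ren (\<lambda>i. ?N - 1 - i) Q"
        unfolding Q_def ren_subst by (intro subst_cong index fvM)
      moreover have "upsn c (case_nat ?A Var) (upn c (up (\<lambda>i. i + b)) ?n) = Var ?N"
        by (simp add: upsn_def upn_def)
      ultimately show ?thesis
        by (simp add: Z_def Z'_def)
    qed
    finally show "App (ren (\<lambda>i. i + b) X) ?A \<simeq> bnd (g (Suc (a + b) + (a + b)) c) Z'" .
  qed
  also have "\<dots> = lam (bnd (g 1 a @ (g (Suc a) b @ g (Suc (a + b)) c)) Z')"
    by (simp add: bnd_append add_ac)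
  also have "\<dots> = box_body ?N Q"
    using g_add[of 1 a "b + c"] g_add[of "Suc a" b c]
    by (simp add: box_body_def Z'_def g_def add_ac)
  also have "\<dots> \<simeq> box_body ?N (cps0 (box_inst a b V M))"
    by (intro ceq_box_body ceq_sym[OF Q])
  finally show ?thesis .
qed

lemma ren_vars: "map (ren (\<lambda>i. i + n)) (vars m) @ vars n = vars (m + n)"
  by (simp add: vars_add)

lemma vars_Suc: "vars (Suc n) = Var n # vars n"
  using vars_add[of 1 n] by (simp add: vars_def[of "Suc 0"])

lemma cps0_box_merge:
  assumes V: "is_val V" and ps: "\<forall>(\<tau>, W)\<in>set ps. is_val W"
    and wf: "wf_tm (Box (ps @ (\<sigma>, Box ls V) # qs) M)" and k: "wf_tm k"
  shows "App (cps0 (Box (ps @ (\<sigma>, Box ls V) # qs) M)) k \<simeq>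
    App (cps0 (Box (ps @ ls @ qs) (box_inst (length ps) (length ls) V M))) k"
proof -
  let ?a = "length ps" and ?b = "length ls" and ?c = "length qs"
  let ?M' = "box_inst ?a ?b V M"
  let ?BV = "box_body ?b (cps0 V)" and ?B = "box_body (Suc (?a + ?c)) (cps0 M)"
    and ?B' = "box_body (?a + ?b + ?c) (cps0 ?M')"
  let ?As = "\<lambda>m. map (\<lambda>x. ren (\<lambda>i. i + m) (vt (snd x))) ps"
  let ?X = "bx (vars ?b) ?BV"
  let ?L = "map (\<lambda>x. cps0 (snd x)) ls"
  let ?Q = "map (\<lambda>x. ren (\<lambda>i. i + ?b) (cps0 (snd x))) qs"
  have wf': "wf_tm (Box (ps @ ls @ qs) ?M')"
    using wf by (rule wf_Box_merge)
  have wfs: "\<forall>x\<in>set ps. wf_tm (snd x)" "\<forall>x\<in>set ls. wf_tm (snd x)" "\<forall>x\<in>set qs. wf_tm (snd x)"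
    "wf_tm V" "fv V \<subseteq> {..<?b}" "wf_tm M" "fv M \<subseteq> {..<Suc (?a + ?c)}"
    using wf by auto
  have fv_bodies: "fv ?BV \<subseteq> {..<?b}" "fv ?B \<subseteq> {..<Suc (?a + ?c)}"
    using wfs fv_cps0[of V] fv_cps0[of M] by (auto intro!: fv_box_body)
  have wfX: "wf_tm ?X"
    using wfs fv_bodies by (auto simp: wf_cps0 wf_vars)
  have "returns (cps0 (snd x)) (vt (snd x))" if "x \<in> set ps" for x
    using wfs ps that by (intro returns_vt) auto
  then have vals: "list_all2 returns (map (\<lambda>x. cps0 (snd x)) ps) (map (\<lambda>x. vt (snd x)) ps)"
    by (auto simp: list_all2_map1 list_all2_map2 intro: list.rel_refl_strong)

  define K where "K = bnd (map (\<lambda>x. lift (cps0 (snd x))) qs)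
    (App (ren (\<lambda>i. i + Suc ?c) k) (bx (?As (Suc ?c) @ vars (Suc ?c)) ?B))"
  have kk: "kk (BoxHole ps \<sigma> qs M) k = lam K"
    by (simp add: K_def Let_def)
  have wfK: "wf_tm K"
    using wfs fv_bodies k by (auto simp: K_def wf_cps0 wf_vt wf_vars)
  have "App (cps0 (Box (ps @ (\<sigma>, Box ls V) # qs) M)) k \<simeq> App (cps0 (Box ls V)) (lam K)"
    using cps0_plug[of "BoxHole ps \<sigma> qs M" "Box ls V" k] ps wf k unfolding kk by simp
  also have "\<dots> \<simeq> bnd ?L (App (ren (\<lambda>i. i + ?b) (lam K)) ?X)"
    using wfs wfK by (intro cps0_Box) auto
  also have "\<dots> \<simeq> bnd ?L (inst (ren (up (\<lambda>i. i + ?b)) K) ?X)"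
    unfolding ren.simps using wfs wfK wfX
    by (intro ceq_bnd_body ceq_beta) (auto simp: wf_cps0)
  also have "inst (ren (up (\<lambda>i. i + ?b)) K) ?X = bnd ?Q (App (ren (\<lambda>i. i + (?b + ?c)) k)
      (bx (?As (?b + ?c) @ (bx (map (ren (\<lambda>i. i + ?c)) (vars ?b)) ?BV) # vars ?c) ?B))"
  proof -
    let ?s = "\<lambda>i. upsn ?c (case_nat ?X Var) (upn ?c (up (\<lambda>i. i + ?b)) i)"
    have shift: "subst (\<lambda>i. ?s (i + Suc ?c)) P = ren (\<lambda>i. i + (?b + ?c)) P" for P
      unfolding ren_eq_subst by (rule subst_cong) (simp add: upsn_def upn_def add_ac)
    have hole: "?s ?c = bx (map (ren (\<lambda>i. i + ?c)) (vars ?b)) ?BV"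
      by (simp add: upsn_def upn_def comp_def)
    have tail: "map (\<lambda>N. (undefined, subst ?s N)) (vars ?c) = map (Pair undefined) (vars ?c)"
      by (auto simp: vars_def upsn_def upn_def)
    show ?thesis
      using shift hole tail
      by (simp add: K_def inst_def comp_def vars_Suc ren_eq_subst[symmetric])
  qed
  also have "bnd ?L (bnd ?Q (App (ren (\<lambda>i. i + (?b + ?c)) k)
      (bx (?As (?b + ?c) @ (bx (map (ren (\<lambda>i. i + ?c)) (vars ?b)) ?BV) # vars ?c) ?B))) \<simeq>
    bnd ?L (bnd ?Q (App (ren (\<lambda>i. i + (?b + ?c)) k) (bx (?As (?b + ?c) @ vars (?b + ?c)) ?B')))"
  proof (intro ceq_bnd_body ceq_App ceq_refl)
    let ?p = "map (Pair undefined) (?As (?b + ?c))"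
    let ?l = "map (Pair undefined) (map (ren (\<lambda>i. i + ?c)) (vars ?b))"
    let ?q = "map (Pair undefined) (vars ?c)"
    let ?Box = "Box (?p @ (undefined, Box ?l ?BV) # ?q) ?B"
    have wfB: "wf_tm ?Box"
      using wfs fv_bodies by (auto simp: wf_cps0 wf_vt wf_vars)
    have "?Box \<simeq> Box (?p @ ?l @ ?q) (box_inst ?a ?b ?BV ?B)"
      using ceq_box_merge[OF wfB] by simp
    also have "\<dots> \<simeq> Box (?p @ ?l @ ?q) ?B'"
    proof (rule ceq_Box_body)
      show "box_inst ?a ?b ?BV ?B \<simeq> ?B'"
        using V wfs by (intro box_body_merge)
      show "wf_tm (Box (?p @ ?l @ ?q) (box_inst ?a ?b ?BV ?B))"
        using ceq_wf(2)[OF calculation] .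
      have "fv (cps0 ?M') \<subseteq> {..<?a + ?b + ?c}"
        using fv_cps0[of ?M'] wf' by (auto simp: add_ac)
      then show "fv ?B' \<subseteq> {..<length (?p @ ?l @ ?q)}"
        using fv_box_body by (simp add: add_ac)
    qed
    also have "?p @ ?l @ ?q = map (Pair undefined) (?As (?b + ?c) @ vars (?b + ?c))"
      unfolding ren_vars[symmetric] map_append ..
    finally show "bx (?As (?b + ?c) @ (bx (map (ren (\<lambda>i. i + ?c)) (vars ?b)) ?BV) # vars ?c) ?B \<simeq>
        bx (?As (?b + ?c) @ vars (?b + ?c)) ?B'"
      by simp
  qed (use wfs k in \<open>auto simp: wf_cps0\<close>)
  also have "\<dots> \<simeq> App (cps0 (Box (ps @ ls @ qs) ?M')) k"
    by (rule ceq_sym, insert cps0_Box_returns[OF wf' k vals])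
      (simp add: bnd_append comp_def add_ac)
  finally show ?thesis .
qed

section \<open>Soundness\<close>

lemma cbv_root_ceq:
  assumes "cbv_root M N" "wf_tm M" "wf_tm N" "wf_tm k"
  shows "App (cps0 M) k \<simeq> App (cps0 N) k"
  using assms
proof (induction rule: cbv_root.induct)
  case (beta_id \<sigma> M)
  have "App (cps0 (App (Lam \<sigma> (Var 0)) M)) k \<simeq> App (cps0 M) (lam (App (cps0 (Var 0)) (lift k)))"
    using beta_id by (intro cps0_let) auto
  also have "App (cps0 M) (lam (App (cps0 (Var 0)) (lift k))) \<simeq> App (cps0 M) (lam (App (lift k) (Var 0)))"
    using cps0_val[of "Var 0" "lift k"] beta_id
    by (intro ceq_App[OF ceq_refl] ceq_Lam) (simp_all add: wf_cps0 del: cps0.simps)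
  also have "\<dots> \<simeq> App (cps0 M) k"
    using beta_id by (intro ceq_App ceq_refl wf_cps0 ceq_eta)
  finally show ?case .
next
  case (beta_val V \<sigma> M)
  let ?P = "App (cps0 M) (lift k)"
  have wf: "wf_tm M" "wf_tm V"
    using beta_val by auto
  have "App (cps0 (App (Lam \<sigma> M) V)) k \<simeq> App (cps0 V) (lam ?P)"
    using beta_val by (intro cps0_let) auto
  also have "\<dots> \<simeq> App (lam ?P) (vt V)"
    using beta_val by (intro cps0_val) (auto simp: wf_cps0)
  also have "\<dots> \<simeq> inst ?P (vt V)"
    using beta_val by (intro ceq_beta) (auto simp: wf_cps0 wf_vt)
  also have "\<dots> = App (inst (cps0 M) (vt V)) k"
    by (simp add: inst_def)
  also have "\<dots> \<simeq> App (cps0 (inst M V)) k"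
    using cps0_inst[of V M] beta_val wf by (intro ceq_App ceq_refl ceq_sym[OF cps0_inst])
  finally show ?case .
next
  case (eta_val V \<sigma>)
  let ?V = "\<lambda>n. ren (\<lambda>i. i + n) V"
  let ?M = "App (lift V) (Var 0)"
  have M: "ren (case_nat 0 (\<lambda>i. i + 2)) (cps0 ?M) = cps0 (App (?V 2) (Var 0))"
    by (simp only: cps0_ren[symmetric] ren.simps ren_ren) simp
  have "App (cps0 (App (?V 2) (Var 0))) (Var 1) \<simeq> App (cps0 (Var 0)) (App (vt (?V 2)) (Var 1))"
    using eta_val by (intro cps0_App_val) simp_all
  also have "\<dots> \<simeq> App (App (vt (?V 2)) (Var 1)) (vt (Var 0))"
    using eta_val by (intro cps0_val) (simp_all add: wf_vt)
  also have "\<dots> = App (lift (App (lift (vt V)) (Var 0))) (Var 0)"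
    by (simp add: vt_ren)
  finally have "lam_val (cps0 ?M) \<simeq> lam (lam (App (lift (App (lift (vt V)) (Var 0))) (Var 0)))"
    unfolding lam_val_def M by (intro ceq_Lam)
  also have "\<dots> \<simeq> lam (App (lift (vt V)) (Var 0))"
    using eta_val by (intro ceq_Lam ceq_eta) (simp add: wf_vt)
  also have "\<dots> \<simeq> vt V"
    using eta_val by (intro ceq_eta) (simp add: wf_vt)
  finally have lam: "vt (Lam \<sigma> ?M) \<simeq> vt V"
    by (simp only: vt.simps)
  have "App (cps0 (Lam \<sigma> ?M)) k \<simeq> App k (vt (Lam \<sigma> ?M))"
    using eta_val by (intro cps0_val) simp_all
  also have "\<dots> \<simeq> App k (vt V)"
    using eta_val lam by (intro ceq_App ceq_refl)
  also have "\<dots> \<simeq> App (cps0 V) k"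
    using eta_val by (intro ceq_sym[OF cps0_val])
  finally show ?case .
next
  case (let_out C \<sigma> M N)
  have wf: "wf_tm (App (Lam \<sigma> M) N)"
    using let_out by (blast dest: wf_plugD)
  then have wf': "wf_tm (plug (lift_frame C) M)" "wf_tm M" "wf_tm N"
    using let_out by (auto intro: wf_plug_lift)
  have eq: "App (cps0 (plug C (App (Lam \<sigma> M) N))) k \<simeq> App (cps0 (App (Lam \<sigma> M) N)) (kk C k)"
    using let_out by (intro cps0_plug)
  then have wfk: "wf_tm (kk C k)"
    by (auto dest: ceq_wf)
  note eq
  also have "App (cps0 (App (Lam \<sigma> M) N)) (kk C k) \<simeq> App (cps0 N) (lam (App (cps0 M) (lift (kk C k))))"
    using wf' wfk by (intro cps0_let)
  also have "\<dots> \<simeq> App (cps0 N) (lam (App (cps0 (plug (lift_frame C) M)) (lift k)))"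
    unfolding lift_kk using let_out wf'
    by (intro ceq_App ceq_Lam ceq_refl ceq_sym[OF cps0_plug] wf_cps0 simple_lift) simp_all
  also have "\<dots> \<simeq> App (cps0 (App (Lam \<sigma> (plug (lift_frame C) M)) N)) k"
    using let_out wf' by (intro ceq_sym[OF cps0_let])
  finally show ?case .
next
  case (name_app C y M \<tau>)
  let ?yM = "App (Var y) M"
  have wf: "wf_tm ?yM" "wf_tm (plug (lift_frame C) (Var 0))"
    using name_app by (auto dest: wf_plugD intro: wf_plug_lift)
  have eq: "App (cps0 (plug C ?yM)) k \<simeq> App (cps0 ?yM) (kk C k)"
    using name_app by (intro cps0_plug)
  then have wfk: "wf_tm (kk C k)"
    by (auto dest: ceq_wf)
  have "App (cps0 (plug (lift_frame C) (Var 0))) (lift k) \<simeq> App (cps0 (Var 0)) (kk (lift_frame C) (lift k))"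
    using name_app wf by (intro cps0_plug simple_lift) simp_all
  also have "\<dots> \<simeq> App (lift (kk C k)) (vt (Var 0))"
    unfolding lift_kk[symmetric] using wfk by (intro cps0_val) simp_all
  finally have "lam (App (cps0 (plug (lift_frame C) (Var 0))) (lift k)) \<simeq> lam (App (lift (kk C k)) (Var 0))"
    by (intro ceq_Lam) simp
  also have "\<dots> \<simeq> kk C k"
    using wfk by (rule ceq_eta)
  finally have K: "lam (App (cps0 (plug (lift_frame C) (Var 0))) (lift k)) \<simeq> kk C k" .
  have "App (cps0 (App (Lam \<tau> (plug (lift_frame C) (Var 0))) ?yM)) k \<simeq>
      App (cps0 ?yM) (lam (App (cps0 (plug (lift_frame C) (Var 0))) (lift k)))"
    using name_app wf by (intro cps0_let)
  also have "\<dots> \<simeq> App (cps0 ?yM) (kk C k)"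
    using K wf by (intro ceq_App ceq_refl wf_cps0)
  finally show ?case
    by (rule ceq_trans[OF eq ceq_sym])
next
  case (unname_arg E \<sigma> y M)
  let ?yx = "App (Var (Suc y)) (Var 0)"
  let ?K = "fold kk E k"
  have wf: "wf_tm (plugs (map lift_frame E) ?yx)" "wf_tm M"
    using unname_arg by auto
  have simple: "list_all simple (map lift_frame E)"
    using unname_arg by (auto simp: list_all_iff simple_lift)
  have eq: "App (cps0 (plugs E (App (Var y) M))) k \<simeq> App (cps0 (App (Var y) M)) ?K"
    using unname_arg by (intro cps0_plugs)
  then have wfk: "wf_tm ?K"
    by (auto dest: ceq_wf)
  have "App (cps0 (plugs (map lift_frame E) ?yx)) (lift k) \<simeq> App (cps0 ?yx) (lift ?K)"
    unfolding lift_fold_kk using simple wf unname_arg by (intro cps0_plugs) simp_all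
  also have "\<dots> \<simeq> App (cps0 (Var 0)) (App (vt (Var (Suc y))) (lift ?K))"
    using wfk by (intro cps0_App_val) simp_all
  also have "\<dots> \<simeq> App (App (vt (Var (Suc y))) (lift ?K)) (vt (Var 0))"
    using wfk by (intro cps0_val) simp_all
  finally have "lam (App (cps0 (plugs (map lift_frame E) ?yx)) (lift k)) \<simeq>
      lam (App (lift (App (Var y) ?K)) (Var 0))"
    by (intro ceq_Lam) simp
  also have "\<dots> \<simeq> App (Var y) ?K"
    using wfk by (intro ceq_eta) simp
  finally have K: "lam (App (cps0 (plugs (map lift_frame E) ?yx)) (lift k)) \<simeq> App (Var y) ?K" .
  have "App (cps0 (App (Lam \<sigma> (plugs (map lift_frame E) ?yx)) M)) k \<simeq>
      App (cps0 M) (lam (App (cps0 (plugs (map lift_frame E) ?yx)) (lift k)))"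
    using wf unname_arg by (intro cps0_let)
  also have "\<dots> \<simeq> App (cps0 M) (App (Var y) ?K)"
    using wf K by (intro ceq_App ceq_refl wf_cps0)
  also have "\<dots> \<simeq> App (cps0 (App (Var y) M)) ?K"
    by (rule ceq_sym, insert cps0_App_val[of "Var y" M ?K]) (use wf wfk in simp)
  also have "\<dots> \<simeq> App (cps0 (plugs E (App (Var y) M))) k"
    by (rule ceq_sym[OF eq])
  finally show ?case .
next
  case (box_id_val \<sigma> M)
  let ?B = "box_body 1 (cps0 (Var 0))"
  have body: "?B = lam (App (Var 1) (lam (App (cps0 (Var 0)) (Var 1))))"
    by (simp add: box_body_def)
  have "lam (App (cps0 (Var 0)) (Var 1)) \<simeq> lam (App (Var 1) (vt (Var 0)))"
    by (intro ceq_Lam cps0_val) simp_all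
  also have "\<dots> = lam (App (lift (Var 0)) (Var 0))"
    by simp
  also have "\<dots> \<simeq> Var 0"
    by (rule ceq_eta) simp
  finally have "?B \<simeq> lam (App (lift (Var 0)) (Var 0))"
    unfolding body by (auto intro!: ceq_Lam ceq_App ceq_refl)
  also have "\<dots> \<simeq> Var 0"
    by (rule ceq_eta) simp
  finally have B: "?B \<simeq> Var 0" .
  have "bx [Var 0] ?B \<simeq> bx [Var 0] (Var 0)"
    using B fv_box_body[of "cps0 (Var 0)" 1] ceq_wf(1)[OF B] by (intro ceq_Box_body) auto
  also have "\<dots> \<simeq> Var 0"
    using ceq_box_id[of "Var 0"] by simp
  finally have box: "bx [Var 0] ?B \<simeq> Var 0" .
  have "App (cps0 (Box [(\<sigma>, M)] (Var 0))) k \<simeq> App (cps0 M) (lam (App (lift k) (bx [Var 0] ?B)))"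
    using cps0_Box[of "[(\<sigma>, M)]" "Var 0" k] box_id_val
    by (simp add: vars_def del: cps0.simps)
  also have "\<dots> \<simeq> App (cps0 M) (lam (App (lift k) (Var 0)))"
    using box box_id_val by (intro ceq_App[OF ceq_refl] ceq_Lam) (simp_all add: wf_cps0)
  also have "\<dots> \<simeq> App (cps0 M) k"
    using box_id_val by (intro ceq_App ceq_refl wf_cps0 ceq_eta)
  finally show ?case .
next
  case (box_merge_val ps V \<sigma> ls qs M)
  then show ?case
    by (intro cps0_box_merge)
qed

lemma cps0_Box_cong:
  assumes "list_all2 (\<lambda>x y. cps0 (snd x) \<simeq> cps0 (snd y)) xs ys" "cps0 M \<simeq> cps0 N"
    and "fv M \<subseteq> {..<length xs}" "fv N \<subseteq> {..<length xs}"
  shows "cps0 (Box xs M) \<simeq> cps0 (Box ys N)"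
proof -
  let ?n = "length xs"
  have len: "length ys = ?n"
    using assms(1) by (simp add: list_all2_lengthD)
  have fv: "fv (box_body ?n (cps0 M)) \<subseteq> {..<?n}" "fv (box_body ?n (cps0 N)) \<subseteq> {..<?n}"
    using assms fv_cps0[of M] fv_cps0[of N] by (auto intro!: fv_box_body)
  have "bx (vars ?n) (box_body ?n (cps0 M)) \<simeq> bx (vars ?n) (box_body ?n (cps0 N))"
    using fv assms(2) ceq_wf(1)[OF assms(2)]
    by (intro ceq_Box_body ceq_box_body) (auto simp: wf_vars)
  moreover have "list_all2 (\<simeq>) (map (\<lambda>x. lift (cps0 (snd x))) xs) (map (\<lambda>x. lift (cps0 (snd x))) ys)"
    using assms(1) by (auto simp: list_all2_map1 list_all2_map2 intro: ceq_ren elim: list_all2_mono)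
  ultimately have "lam (bnd (map (\<lambda>x. lift (cps0 (snd x))) xs)
      (App (Var ?n) (bx (vars ?n) (box_body ?n (cps0 M))))) \<simeq>
    lam (bnd (map (\<lambda>x. lift (cps0 (snd x))) ys)
      (App (Var ?n) (bx (vars ?n) (box_body ?n (cps0 N)))))"
    by (intro ceq_Lam ceq_bnd ceq_App ceq_refl) simp_all
  then show ?thesis
    by (simp add: case_prod_beta' len)
qed

lemma ctx_closure_cbv_root_ceq:
  "ctx_closure cbv_root M N \<Longrightarrow> wf_tm M \<Longrightarrow> wf_tm N \<Longrightarrow> cps0 M \<simeq> cps0 N"
proof (induction rule: ctx_closure.induct)
  case (root M N)
  show ?case
    by (rule ceq_ext[OF wf_cps0 wf_cps0 cbv_root_ceq]) (simp_all add: root)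
next
  case (lam M N \<sigma>)
  then show ?case
    unfolding cps0.simps by (intro ceq_Lam ceq_App ceq_refl ceq_ren ceq_lam_val) simp_all
next
  case (app_left M N P)
  then show ?case
    unfolding cps0.simps by (intro ceq_Lam ceq_App ceq_refl ceq_ren) (simp_all add: wf_cps0)
next
  case (app_right M N P)
  then show ?case
    unfolding cps0.simps by (intro ceq_Lam ceq_App ceq_refl ceq_ren) (simp_all add: wf_cps0)
next
  case (box_arg M N ps \<sigma> qs P)
  then show ?case
    by (intro cps0_Box_cong list_all2_appendI list.rel_refl_strong)
      (auto intro!: ceq_refl wf_cps0 list.rel_refl_strong)
next
  case (box_body M N ps)
  then show ?case
    by (intro cps0_Box_cong list.rel_refl_strong) (auto intro!: ceq_refl wf_cps0)
qed

theorem theorem3: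
  fixes R :: 'b and S :: "'c \<Rightarrow> 'b ty" and G :: "nat \<Rightarrow> 'b ty" and M N :: "('b, 'c) tm"
  assumes "wf_tm M" and "wf_tm N" and "M =\<^sub>v N"
  shows "cps R S G M =\<^sub>n cps R S G N"
proof -
  have "equivclp (\<lambda>M N. wf_tm M \<and> wf_tm N \<and> cbv_step M N) M N"
    using assms(3) by (simp add: cbv_eq_def conversion_def)
  then have "cps0 M \<simeq> cps0 N"
  proof (induction rule: equivclp_induct)
    case base
    show ?case
      using assms(1) by (intro ceq_refl wf_cps0)
  next
    case (step P Q)
    then have "cps0 P \<simeq> cps0 Q"
      using ctx_closure_cbv_root_ceq ceq_sym unfolding cbv_step_def by blast
    with step.IH show ?case
      by (rule ceq_trans)
  qed
  with assms(1) have "cps R S G M \<simeq> cps0 N"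
    by (blast intro: cps_ceq_cps0 ceq_trans)
  also have "\<dots> \<simeq> cps R S G N"
    using assms(2) by (intro ceq_sym[OF cps_ceq_cps0])
  finally have "cps R S G M \<simeq> cps R S G N" .
  then show ?thesis
    by (simp add: ceq_def)
qed

end
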